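(* Let $n\ge 2$, let $A\in\mathbb{R}^{n^2\times n^2}$ be symmetric and $b\in\mathbb{R}^{n^2}$, and consider the assignment-polytope constrained quadratic program (ASQP) of minimizing $f(x)=x^TAx+2b^Tx$ subject to $x\in F$, where \[ F=\Big\{x=(x_{i,j})\in\mathbb{R}^{n^2}:\ \sum_{i=1}^n x_{i,j}=1\ (j=1,\ldots,n),\ \sum_{j=1}^n x_{i,j}=1\ (i=1,\ldots,n),\ x_{i,j}\ge 0\ (i,j=1,\ldots,n)\Big\}. \] Let \[ g(n):=\frac{4}{n^2\left(\sqrt{\left\lceil\frac{\sqrt{8n^2+17}-3}{2}\right\rceil}+1-\frac{2}{n}\right)^2}. \] Then a $(1-g(n))$-minimal solution of (ASQP) can be found in polynomial time.
   Context: Let $\overline{p}$ and $\underline{p}$ denote the maximal and minimal values of $f(x)$ over $F$, respectively. For $\epsilon\in[0,1]$, an $\epsilon$-minimal solution (also called $\epsilon$-minimizer) of (ASQP) is a point $x\in F$ such that \[ \frac{f(x)-\underline{p}}{\overline{p}-\underline{p}}\le\epsilon, \] where, in the degenerate case $\overline{p}=\underline{p}$, the condition is read as $f(x)-\underline{p}\le\epsilon(\overline{p}-\underline{p})$. *)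

theory Defs
  imports "Jordan_Normal_Form.Matrix"
begin

section \<open>The assignment-polytope constrained quadratic program\<close>

text \<open>
  A point x of R^(n^2) is a vector of dimension n^2; its entry x_(i,j) (indices counted from 0)
  is x $ (i * n + j).
\<close>

definition assignment_polytope :: "nat \<Rightarrow> real vec set" where
  "assignment_polytope n = {x \<in> carrier_vec (n\<^sup>2).
     (\<forall>j<n. (\<Sum>i<n. x $ (i * n + j)) = 1) \<and>
     (\<forall>i<n. (\<Sum>j<n. x $ (i * n + j)) = 1) \<and>
     (\<forall>i<n. \<forall>j<n. x $ (i * n + j) \<ge> 0)}"

definition asqp_objective :: "real mat \<Rightarrow> real vec \<Rightarrow> real vec \<Rightarrow> real" where
  "asqp_objective A b x = x \<bullet> (A *\<^sub>v x) + 2 * (b \<bullet> x)"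

text \<open>
  For n >= 1 the polytope is compact and nonempty and the objective is continuous, so this
  supremum and this infimum are attained.
\<close>

definition asqp_max :: "nat \<Rightarrow> real mat \<Rightarrow> real vec \<Rightarrow> real" where
  "asqp_max n A b = (SUP x\<in>assignment_polytope n. asqp_objective A b x)"

definition asqp_min :: "nat \<Rightarrow> real mat \<Rightarrow> real vec \<Rightarrow> real" where
  "asqp_min n A b = (INF x\<in>assignment_polytope n. asqp_objective A b x)"

definition eps_minimal_solution ::
    "real \<Rightarrow> nat \<Rightarrow> real mat \<Rightarrow> real vec \<Rightarrow> real vec \<Rightarrow> bool" where
  "eps_minimal_solution \<epsilon> n A b x \<longleftrightarrow> x \<in> assignment_polytope n \<and>
     (if asqp_max n A b = asqp_min n A b
      then asqp_objective A b x - asqp_min n A b \<le> \<epsilon> * (asqp_max n A b - asqp_min n A b)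
      else (asqp_objective A b x - asqp_min n A b) / (asqp_max n A b - asqp_min n A b) \<le> \<epsilon>)"

definition asqp_g :: "nat \<Rightarrow> real" where
  "asqp_g n = 4 / ((real n)\<^sup>2 *
     (sqrt (of_int \<lceil>(sqrt (8 * (real n)\<^sup>2 + 17) - 3) / 2\<rceil>) + 1 - 2 / real n)\<^sup>2)"


section \<open>Polynomial time over the reals: the real RAM\<close>

text \<open>
  As the data are real numbers, polynomial time is meant in the unit-cost model of computation
  over the reals (real RAM, or equivalently up to polynomial factors, Blum-Shub-Smale machine):
  each real number occupies one memory cell, and field operations and comparisons of reals cost
  one unit. A program has finitely many natural number registers, used for counting and for
  addressing, and an infinite array of real cells. There is no rounding, no root extraction,
  no real constant other than the natural numbers, and no integer division or bit operation.
  Division by zero returns 0.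
\<close>

type_synonym ram_state = "(nat \<Rightarrow> nat) \<times> (nat \<Rightarrow> real)"

datatype nexp =
    NConst nat
  | NReg nat
  | NAdd nexp nexp
  | NSub nexp nexp
  | NMul nexp nexp

datatype rexp =
    RCell nexp
  | ROfNat nexp
  | RAdd rexp rexp
  | RSub rexp rexp
  | RMul rexp rexp
  | RDiv rexp rexp

datatype bexp =
    NLess nexp nexp
  | RLess rexp rexp
  | BNot bexp
  | BAnd bexp bexp

fun nval :: "nexp \<Rightarrow> ram_state \<Rightarrow> nat" where
  "nval (NConst k) s = k"
| "nval (NReg r) s = fst s r"
| "nval (NAdd a b) s = nval a s + nval b s"
| "nval (NSub a b) s = nval a s - nval b s"
| "nval (NMul a b) s = nval a s * nval b s"

fun rval :: "rexp \<Rightarrow> ram_state \<Rightarrow> real" where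
  "rval (RCell a) s = snd s (nval a s)"
| "rval (ROfNat a) s = real (nval a s)"
| "rval (RAdd a b) s = rval a s + rval b s"
| "rval (RSub a b) s = rval a s - rval b s"
| "rval (RMul a b) s = rval a s * rval b s"
| "rval (RDiv a b) s = rval a s / rval b s"

fun bval :: "bexp \<Rightarrow> ram_state \<Rightarrow> bool" where
  "bval (NLess a b) s = (nval a s < nval b s)"
| "bval (RLess a b) s = (rval a s < rval b s)"
| "bval (BNot a) s = (\<not> bval a s)"
| "bval (BAnd a b) s = (bval a s \<and> bval b s)"

datatype ram_prog =
    Skip
  | SetReg nat nexp
  | SetCell nexp rexp
  | Seq ram_prog ram_prog
  | If bexp ram_prog ram_prog
  | While bexp ram_prog

text \<open>
  ram_exec c s t s': program c started in state s halts in state s' after t steps. Expressions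
  are part of the program text, hence of a size that does not depend on the input; charging one
  unit for each executed command or test thus counts the operations up to a constant factor.
\<close>

inductive ram_exec :: "ram_prog \<Rightarrow> ram_state \<Rightarrow> nat \<Rightarrow> ram_state \<Rightarrow> bool" where
  Skip: "ram_exec Skip s 1 s"
| SetReg: "ram_exec (SetReg r a) s 1 ((fst s)(r := nval a s), snd s)"
| SetCell: "ram_exec (SetCell a e) s 1 (fst s, (snd s)(nval a s := rval e s))"
| Seq: "ram_exec c s t s' \<Longrightarrow> ram_exec d s' u s'' \<Longrightarrow> ram_exec (Seq c d) s (t + u) s''"
| IfTrue: "bval b s \<Longrightarrow> ram_exec c s t s' \<Longrightarrow> ram_exec (If b c d) s (t + 1) s'"
| IfFalse: "\<not> bval b s \<Longrightarrow> ram_exec d s t s' \<Longrightarrow> ram_exec (If b c d) s (t + 1) s'"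
| WhileFalse: "\<not> bval b s \<Longrightarrow> ram_exec (While b c) s 1 s"
| WhileTrue: "bval b s \<Longrightarrow> ram_exec c s t s' \<Longrightarrow> ram_exec (While b c) s' u s''
    \<Longrightarrow> ram_exec (While b c) s (t + u + 1) s''"

lemma ram_exec_deterministic:
  assumes "ram_exec c s t s'" and "ram_exec c s u s''"
  shows "u = t \<and> s'' = s'"
  using assms
proof (induction arbitrary: u s'' rule: ram_exec.induct)
  case (Skip s)
  then show ?case by (cases rule: ram_exec.cases) auto
next
  case (SetReg r a s)
  then show ?case by (cases rule: ram_exec.cases) auto
next
  case (SetCell a e s)
  then show ?case by (cases rule: ram_exec.cases) auto
next
  case (Seq c s t s' d v s3)
  from Seq.prems show ?case by (cases rule: ram_exec.cases) (use Seq.IH in blast)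
next
  case (IfTrue b s c t s' d)
  from IfTrue.prems show ?case by (cases rule: ram_exec.cases) (use IfTrue in blast)+
next
  case (IfFalse b s d t s' c)
  from IfFalse.prems show ?case by (cases rule: ram_exec.cases) (use IfFalse in blast)+
next
  case (WhileFalse b s c)
  from WhileFalse.prems show ?case
    by (cases rule: ram_exec.cases) (use WhileFalse.hyps in blast)+
next
  case (WhileTrue b s c t s' v s3)
  from WhileTrue.prems show ?case
    by (cases rule: ram_exec.cases) (use WhileTrue in blast)+
qed

text \<open>
  The input, a finite sequence of reals, is stored in the first cells and its length in
  register 0; all other registers and cells are 0. The output is read off in the same way.
\<close>

definition ram_input :: "real list \<Rightarrow> ram_state" where
  "ram_input xs = ((\<lambda>r. if r = 0 then length xs else 0),
                   (\<lambda>i. if i < length xs then xs ! i else 0))"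

definition ram_output :: "ram_state \<Rightarrow> real list" where
  "ram_output s = map (snd s) [0..<fst s 0]"

text \<open>
  A search problem is given by a set of instances, an encoding of instances as sequences of
  reals, and the relation between instances and acceptable outputs. One program has to serve
  all instances, within a time bound polynomial in the length of the encoded instance.
\<close>

definition poly_time_solvable ::
    "'i set \<Rightarrow> ('i \<Rightarrow> real list) \<Rightarrow> ('i \<Rightarrow> real list \<Rightarrow> bool) \<Rightarrow> bool" where
  "poly_time_solvable I enc ok \<longleftrightarrow>
     (\<exists>p C k. \<forall>i\<in>I. \<exists>t s. ram_exec p (ram_input (enc i)) t s \<and>
        t \<le> C * (length (enc i) + 1) ^ k \<and> ok i (ram_output s))"


section \<open>Instances\<close>

definition asqp_instances :: "(nat \<times> real mat \<times> real vec) set" where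
  "asqp_instances = {(n, A, b). 2 \<le> n \<and> A \<in> carrier_mat (n\<^sup>2) (n\<^sup>2) \<and>
     A\<^sup>T = A \<and> b \<in> carrier_vec (n\<^sup>2)}"

text \<open>The number n, the rows of A one after the other, and then b: 1 + n^4 + n^2 reals.\<close>

definition asqp_encode :: "nat \<times> real mat \<times> real vec \<Rightarrow> real list" where
  "asqp_encode = (\<lambda>(n, A, b). real n # concat (mat_to_list A) @ list_of_vec b)"

end

theory Submission
  imports Defs
begin

text \<open>
  Write $h = \overline p - f \ge 0$ and let $u = (1/n)_{i,j}$ be the barycentre of the polytope.
  For an entry $a = (i,j)$ let the anchor $z_a$ be the average of all permutation matrices that
  have a 1 in position $a$. The program evaluates $f$ at the mean of every 8-tuple of
  anchors, of which there are $n^{16}$, and returns the best mean. The points tried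
  depend on $n$ alone, and field operations and comparisons suffice to find the best of them.

  Let $\eta$ be the largest value of $h$ at the points tried; it remains to see that no
  point of the polytope has a much larger value of $h$.

  (1) \<^emph>\<open>Sampling.\<close> Let $\mu$ be a convex combination of anchors. The mean of 8 anchors drawn
  independently with these weights has expectation $\mu$, and since $h$ is quadratic the expected
  value of $h$ there is $\frac78 h(\mu) + \frac18 \sum_a w_a h(z_a) \ge \frac78 h(\mu)$.
  Hence $h(\mu) \le \frac87 \eta$ (\<open>quad_sampling\<close>).

  (2) \<^emph>\<open>Extrapolation.\<close> For a doubly stochastic $x$ the point $\mu = \frac1n \sum_a x_a z_a$
  satisfies $x = (n-1)\mu - (n-2)u$ (\<open>anchor_mixture\<close>). Both $\mu$ and $u$ are
  convex combinations of anchors, and $h \ge 0$ at the midpoint of $\mu$ and $u$. A quadratic function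
  on a line is determined by its values at three points, and these bounds give
  $h(x) \le (2n-3)^2 \cdot \frac87 \eta$ (\<open>anchor_means_approximate\<close>).

  (3) \<^emph>\<open>Comparison.\<close> While $(2n-3)^2$ grows quadratically, $1/g(n)$ is of order $n^3$, so that
  $g(n)(2n-3)^2 \le \frac78$ for large $n$; for small $n$ the estimate is nearly tight and uses
  the rounding up in $g$ (\<open>asqp_g_bounds\<close>). Eight draws are enough to make the estimate hold
  for every $n \ge 2$. Hence $g(n) h(x) \le \eta$ for all $x$, which at a minimizer $x$ of $f$
  says that the best point tried is $(1-g(n))$-minimal.

  The program consists of 16 nested loops around the evaluation of $f$, so that its running time is
  of order $n^{20}$. Its correctness is proved with total-correctness rules that carry a time bound.
\<close>

section \<open>Quadratic functions and sampling\<close>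

definition quad :: "'i set \<Rightarrow> ('i \<Rightarrow> 'i \<Rightarrow> real) \<Rightarrow> ('i \<Rightarrow> real) \<Rightarrow> ('i \<Rightarrow> real) \<Rightarrow> real" where
  "quad I M l x = (\<Sum>c\<in>I. \<Sum>d\<in>I. M c d * x c * x d) + 2 * (\<Sum>c\<in>I. l c * x c)"

lemma quad_cong:
  assumes "\<And>c. c \<in> I \<Longrightarrow> x c = y c"
  shows "quad I M l x = quad I M l y"
  unfolding quad_def using assms by simp

lemma quad_add:
  "quad I M l (\<lambda>c. v c + e c) = quad I M l v + quad I M (\<lambda>_. 0) e
     + (\<Sum>c\<in>I. ((\<Sum>d\<in>I. (M c d + M d c) * v d) + 2 * l c) * e c)"
proof -
  have swap: "(\<Sum>c\<in>I. \<Sum>d\<in>I. M c d * v c * e d) = (\<Sum>c\<in>I. \<Sum>d\<in>I. M d c * v d * e c)"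
    by (rule sum.swap)
  have "quad I M l (\<lambda>c. v c + e c) = quad I M l v + quad I M (\<lambda>_. 0) e
     + (\<Sum>c\<in>I. \<Sum>d\<in>I. M c d * v c * e d) + (\<Sum>c\<in>I. \<Sum>d\<in>I. M c d * v d * e c)
     + 2 * (\<Sum>c\<in>I. l c * e c)"
    unfolding quad_def by (simp add: algebra_simps sum.distrib)
  then show ?thesis
    unfolding swap
    by (simp add: algebra_simps sum.distrib sum_distrib_left sum_distrib_right)
qed

lemma quad_scale:
  "quad I M (\<lambda>_. 0) (\<lambda>c. r * e c) = r\<^sup>2 * quad I M (\<lambda>_. 0) e"
  unfolding quad_def by (simp add: sum_distrib_left power2_eq_square algebra_simps)

text \<open>
  A random shift with mean 0 raises the expected value of a quadratic function by the expected value
  of the pure quadratic form at the shift: the terms that are linear in the shift average out.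
\<close>

lemma quad_average:
  assumes "(\<Sum>a\<in>J. w a) = 1" and "\<And>c. c \<in> I \<Longrightarrow> (\<Sum>a\<in>J. w a * e a c) = 0"
  shows "(\<Sum>a\<in>J. w a * quad I M l (\<lambda>c. v c + e a c))
    = quad I M l v + (\<Sum>a\<in>J. w a * quad I M (\<lambda>_. 0) (e a))"
proof -
  define k where "k c = (\<Sum>d\<in>I. (M c d + M d c) * v d) + 2 * l c" for c
  have "(\<Sum>a\<in>J. w a * (\<Sum>c\<in>I. k c * e a c)) = (\<Sum>a\<in>J. \<Sum>c\<in>I. k c * (w a * e a c))"
    by (simp add: sum_distrib_left algebra_simps)
  also have "\<dots> = (\<Sum>c\<in>I. \<Sum>a\<in>J. k c * (w a * e a c))"
    by (rule sum.swap)
  also have "\<dots> = 0"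
    by (simp add: sum_distrib_left[symmetric] assms(2))
  finally have z: "(\<Sum>a\<in>J. w a * (\<Sum>c\<in>I. k c * e a c)) = 0" .
  have "(\<Sum>a\<in>J. w a * quad I M l (\<lambda>c. v c + e a c))
    = (\<Sum>a\<in>J. w a) * quad I M l v + (\<Sum>a\<in>J. w a * quad I M (\<lambda>_. 0) (e a))
      + (\<Sum>a\<in>J. w a * (\<Sum>c\<in>I. k c * e a c))"
    unfolding quad_add k_def[symmetric]
    by (simp add: distrib_left sum.distrib sum_distrib_right)
  then show ?thesis using z assms(1) by simp
qed

lemma exists_le_average:
  fixes w :: "'a \<Rightarrow> real"
  assumes "finite J" "(\<Sum>a\<in>J. w a) = 1" "\<And>a. a \<in> J \<Longrightarrow> 0 \<le> w a" "(\<Sum>a\<in>J. w a * g a) \<le> m"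
  shows "\<exists>a\<in>J. g a \<le> m"
proof (rule ccontr)
  assume "\<not> ?thesis"
  then have gt: "\<And>a. a \<in> J \<Longrightarrow> m < g a" by force
  obtain a where a: "a \<in> J" "0 < w a"
    using assms(1-3) by (metis less_eq_real_def sum.neutral zero_neq_one)
  have "(\<Sum>a\<in>J. w a * m) < (\<Sum>a\<in>J. w a * g a)"
  proof (rule sum_strict_mono_ex1)
    show "\<forall>x\<in>J. w x * m \<le> w x * g x"
      using gt assms(3) by (simp add: less_imp_le mult_left_mono)
    show "\<exists>x\<in>J. w x * m < w x * g x"
      using a gt by (intro bexI[of _ a] mult_strict_left_mono) auto
  qed (rule assms(1))
  moreover have "(\<Sum>a\<in>J. w a * m) = m" 
    using assms(2) by (simp add: sum_distrib_right[symmetric])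
  ultimately show False using assms(4) by simp
qed

text \<open>
  The method of conditional expectations: the shifts are fixed one at a time, each so that the
  expectation over the remaining ones does not increase. The expectation over m independent shifts
  is the value at the mean plus m times the variance term, so no product measure has to be formed.
\<close>

lemma exists_sample_le_expectation:
  fixes w :: "'a \<Rightarrow> real"
  assumes "finite J" "(\<Sum>a\<in>J. w a) = 1" "\<And>a. a \<in> J \<Longrightarrow> 0 \<le> w a"
    and "\<And>c. c \<in> I \<Longrightarrow> (\<Sum>a\<in>J. w a * e a c) = 0"
  shows "\<exists>\<tau>. (\<forall>m. \<tau> m \<in> J) \<and> quad I M l (\<lambda>c. v c + (\<Sum>m<k. e (\<tau> m) c))
    \<le> quad I M l v + real k * (\<Sum>a\<in>J. w a * quad I M (\<lambda>_. 0) (e a))"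
proof (induction k arbitrary: v)
  case 0
  obtain a where "a \<in> J" using assms(2) by fastforce
  then show ?case by (intro exI[of _ "\<lambda>_. a"]) simp
next
  case (Suc k)
  let ?W = "\<Sum>a\<in>J. w a * quad I M (\<lambda>_. 0) (e a)"
  obtain a where a: "a \<in> J" "quad I M l (\<lambda>c. v c + e a c) \<le> quad I M l v + ?W"
    using exists_le_average[OF assms(1-3), of "\<lambda>a. quad I M l (\<lambda>c. v c + e a c)" "quad I M l v + ?W"]
      quad_average[OF assms(2,4), where M = M and l = l and v = v] by auto
  obtain \<tau> where t: "\<forall>m. \<tau> m \<in> J"
    "quad I M l (\<lambda>c. v c + e a c + (\<Sum>m<k. e (\<tau> m) c)) \<le> quad I M l (\<lambda>c. v c + e a c) + real k * ?W"
    using Suc.IH[of "\<lambda>c. v c + e a c"] by blast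
  show ?case
  proof (intro exI[of _ "case_nat a \<tau>"] conjI allI)
    show "case_nat a \<tau> m \<in> J" for m using a(1) t(1) by (cases m) auto
    show "quad I M l (\<lambda>c. v c + (\<Sum>m<Suc k. e (case_nat a \<tau> m) c)) \<le> quad I M l v + real (Suc k) * ?W"
      using a(2) t(2) by (simp add: sum.lessThan_Suc_shift algebra_simps del: sum.lessThan_Suc)
  qed
qed

text \<open>
  The variance term of a mean of k draws is 1/k times that of one draw, which is at most
  $S - q(\mu)$ when $q$ is at most $S$ at all points that may be drawn.
\<close>

lemma quad_sampling:
  fixes w :: "'a \<Rightarrow> real"
  assumes "finite J" and w1: "(\<Sum>a\<in>J. w a) = 1" and "\<And>a. a \<in> J \<Longrightarrow> 0 \<le> w a" and "0 < k"
    and upper: "\<And>a. a \<in> J \<Longrightarrow> quad I M l (z a) \<le> S"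
    and lower: "\<And>\<tau>. (\<And>m. \<tau> m \<in> J) \<Longrightarrow> \<beta> \<le> quad I M l (\<lambda>c. (\<Sum>m<k. z (\<tau> m) c) / real k)"
  shows "(1 - 1 / real k) * (S - quad I M l (\<lambda>c. \<Sum>a\<in>J. w a * z a c)) \<le> S - \<beta>"
proof -
  define \<mu> where "\<mu> = (\<lambda>c. \<Sum>a\<in>J. w a * z a c)"
  define V where "V = (\<Sum>a\<in>J. w a * quad I M (\<lambda>_. 0) (\<lambda>c. z a c - \<mu> c))"
  have centred: "(\<Sum>a\<in>J. w a * (z a c - \<mu> c)) = 0" for c
  proof -
    have "(\<Sum>a\<in>J. w a * (z a c - \<mu> c)) = (\<Sum>a\<in>J. w a * z a c) - (\<Sum>a\<in>J. w a) * \<mu> c"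
      by (simp add: right_diff_distrib sum_subtractf sum_distrib_right)
    then show ?thesis using w1 by (simp add: \<mu>_def)
  qed
  have centred': "(\<Sum>a\<in>J. w a * ((1 / real k) * (z a c - \<mu> c))) = 0" for c
  proof -
    have "(\<Sum>a\<in>J. w a * ((1 / real k) * (z a c - \<mu> c))) = (1 / real k) * (\<Sum>a\<in>J. w a * (z a c - \<mu> c))"
      by (simp only: sum_distrib_left mult.left_commute)
    then show ?thesis by (simp add: centred)
  qed
  obtain \<tau> where \<tau>: "\<forall>m. \<tau> m \<in> J"
    "quad I M l (\<lambda>c. \<mu> c + (\<Sum>m<k. (1 / real k) * (z (\<tau> m) c - \<mu> c)))
    \<le> quad I M l \<mu> + real k * (\<Sum>a\<in>J. w a * quad I M (\<lambda>_. 0) (\<lambda>c. (1 / real k) * (z a c - \<mu> c)))"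
    using exists_sample_le_expectation[OF assms(1-3), of I "\<lambda>a c. (1 / real k) * (z a c - \<mu> c)" M l \<mu> k] centred'
    by blast
  have mean: "\<mu> c + (\<Sum>m<k. (1 / real k) * (z (\<tau> m) c - \<mu> c)) = (\<Sum>m<k. z (\<tau> m) c) / real k" for c
  proof -
    have "(\<Sum>m<k. (1 / real k) * (z (\<tau> m) c - \<mu> c)) = (1 / real k) * ((\<Sum>m<k. z (\<tau> m) c) - real k * \<mu> c)"
      by (simp only: sum_distrib_left[symmetric] sum_subtractf) simp
    then show ?thesis using \<open>0 < k\<close> by (simp only:) (simp add: right_diff_distrib)
  qed
  have "real k * (\<Sum>a\<in>J. w a * quad I M (\<lambda>_. 0) (\<lambda>c. (1 / real k) * (z a c - \<mu> c))) = V / real k"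
  proof -
    have "(\<Sum>a\<in>J. w a * quad I M (\<lambda>_. 0) (\<lambda>c. (1 / real k) * (z a c - \<mu> c))) = (1 / real k)\<^sup>2 * V"
      unfolding V_def by (simp only: quad_scale sum_distrib_left mult.left_commute)
    then show ?thesis using \<open>0 < k\<close> by (simp add: power2_eq_square)
  qed
  then have le: "\<beta> \<le> quad I M l \<mu> + V / real k"
    using \<tau> lower[of \<tau>] unfolding mean by simp
  have "(\<Sum>a\<in>J. w a * quad I M l (z a)) = quad I M l \<mu> + V"
    using quad_average[where e = "\<lambda>a c. z a c - \<mu> c" and v = \<mu>, OF w1 centred] by (simp add: V_def)
  moreover have "(\<Sum>a\<in>J. w a * quad I M l (z a)) \<le> (\<Sum>a\<in>J. w a * S)"
    using assms(3) upper by (intro sum_mono mult_left_mono)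
  moreover have "(\<Sum>a\<in>J. w a * S) = S" using w1 by (simp add: sum_distrib_right[symmetric])
  ultimately have "V \<le> S - quad I M l \<mu>" by simp
  then have "V / real k \<le> (S - quad I M l \<mu>) / real k" using \<open>0 < k\<close> by (simp add: divide_right_mono)
  then show ?thesis using le unfolding \<mu>_def by (simp add: algebra_simps diff_divide_distrib)
qed

text \<open>
  Lagrange interpolation on a line: the value outside the segment from x to y is expressed by the
  values at x, at y and at their midpoint. For s \<open>\<ge>\<close> 1 only the midpoint has a negative
  coefficient, so that one-sided bounds at the three points suffice to bound the left-hand side.
\<close>

lemma quad_three_points:
  "quad I M l (\<lambda>c. s * x c - (s - 1) * y c)
    = s * (2 * s - 1) * quad I M l x + (s - 1) * (2 * s - 1) * quad I M l y
      - 4 * s * (s - 1) * quad I M l (\<lambda>c. (x c + y c) / 2)"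
proof -
  let ?\<alpha> = "s * (2 * s - 1)" and ?\<beta> = "(s - 1) * (2 * s - 1)" and ?\<gamma> = "4 * s * (s - 1)"
  let ?m = "\<lambda>c. (x c + y c) / 2" and ?t = "\<lambda>c. s * x c - (s - 1) * y c"
  have prod: "M c d * ?t c * ?t d = ?\<alpha> * (M c d * x c * x d) + ?\<beta> * (M c d * y c * y d)
      - ?\<gamma> * (M c d * ?m c * ?m d)" for c d
    by (simp add: field_simps power2_eq_square)
  have lin: "l c * ?t c = ?\<alpha> * (l c * x c) + ?\<beta> * (l c * y c) - ?\<gamma> * (l c * ?m c)" for c
    by (simp add: field_simps power2_eq_square)
  show ?thesis
    unfolding quad_def prod lin sum.distrib sum_subtractf sum_distrib_left[symmetric]
    by (simp add: algebra_simps)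
qed

section \<open>Anchors of the assignment polytope\<close>

text \<open>
  For a in the square, the average of the permutation matrices with a 1 at position a: its entries are 1 at a, 0 in the
  rest of the row and the column of a, and 1/(n-1) elsewhere. The product form is what makes
  sums over rows and columns, and over a, easy to compute.
\<close>

definition anchor :: "nat \<Rightarrow> nat \<times> nat \<Rightarrow> nat \<times> nat \<Rightarrow> real" where
  "anchor n a c = 1 / real n + real n / (real n - 1)
     * (of_bool (fst c = fst a) - 1 / real n) * (of_bool (snd c = snd a) - 1 / real n)"

definition doubly_stochastic :: "nat \<Rightarrow> (nat \<times> nat \<Rightarrow> real) \<Rightarrow> bool" where
  "doubly_stochastic n x \<longleftrightarrow> (\<forall>j<n. (\<Sum>i<n. x (i, j)) = 1) \<and> (\<forall>i<n. (\<Sum>j<n. x (i, j)) = 1)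
     \<and> (\<forall>i<n. \<forall>j<n. x (i, j) \<ge> 0)"

lemma doubly_stochastic_mixture:
  assumes "finite J" "(\<Sum>a\<in>J. w a) = 1" "\<And>a. a \<in> J \<Longrightarrow> 0 \<le> w a"
    "\<And>a. a \<in> J \<Longrightarrow> doubly_stochastic n (z a)"
  shows "doubly_stochastic n (\<lambda>c. \<Sum>a\<in>J. w a * z a c)"
proof -
  have "(\<Sum>i<n. \<Sum>a\<in>J. w a * z a (i, j)) = 1" if "j < n" for j
  proof -
    have "(\<Sum>i<n. \<Sum>a\<in>J. w a * z a (i, j)) = (\<Sum>a\<in>J. w a * (\<Sum>i<n. z a (i, j)))"
      by (subst sum.swap) (simp add: sum_distrib_left)
    then show ?thesis using assms(2,4) that by (simp add: doubly_stochastic_def)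
  qed
  moreover have "(\<Sum>j<n. \<Sum>a\<in>J. w a * z a (i, j)) = 1" if "i < n" for i
  proof -
    have "(\<Sum>j<n. \<Sum>a\<in>J. w a * z a (i, j)) = (\<Sum>a\<in>J. w a * (\<Sum>j<n. z a (i, j)))"
      by (subst sum.swap) (simp add: sum_distrib_left)
    then show ?thesis using assms(2,4) that by (simp add: doubly_stochastic_def)
  qed
  ultimately show ?thesis using assms(3,4) unfolding doubly_stochastic_def
    by (auto intro!: sum_nonneg)
qed

lemma doubly_stochastic_anchor:
  assumes "2 \<le> n" "fst a < n" "snd a < n"
  shows "doubly_stochastic n (anchor n a)"
proof -
  have d: "(\<Sum>i<n. of_bool (i = k) - 1 / real n) = 0" if "k < n" for k
  proof -
    have "(\<Sum>i<n. of_bool (i = k) :: real) = 1" using that by (simp add: of_bool_def)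
    then show ?thesis using assms(1) by (simp add: sum_subtractf)
  qed
  have "(\<Sum>i<n. anchor n a (i, j)) = 1" for j
  proof -
    have "(\<Sum>i<n. anchor n a (i, j)) = (\<Sum>i<n. 1 / real n) + real n / (real n - 1)
        * (\<Sum>i<n. of_bool (i = fst a) - 1 / real n) * (of_bool (j = snd a) - 1 / real n)"
      by (simp only: anchor_def fst_conv snd_conv sum.distrib sum_distrib_right sum_distrib_left)
    then show ?thesis using assms d[of "fst a"] by (simp only: mult_zero_right mult_zero_left) simp
  qed
  moreover have "(\<Sum>j<n. anchor n a (i, j)) = 1" for i
  proof -
    have "(\<Sum>j<n. anchor n a (i, j)) = (\<Sum>j<n. 1 / real n) + real n / (real n - 1)
        * (of_bool (i = fst a) - 1 / real n) * (\<Sum>j<n. of_bool (j = snd a) - 1 / real n)"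
      by (simp only: anchor_def fst_conv snd_conv sum.distrib sum_distrib_right sum_distrib_left)
    then show ?thesis using assms d[of "snd a"] by (simp only: mult_zero_right mult_zero_left) simp
  qed
  moreover have "anchor n a c \<ge> 0" for c
    using assms(1) unfolding anchor_def
    by (cases "fst c = fst a"; cases "snd c = snd a") (simp_all add: field_simps)
  ultimately show ?thesis unfolding doubly_stochastic_def by blast
qed

definition square :: "nat \<Rightarrow> (nat \<times> nat) set" where "square n = {..<n} \<times> {..<n}"

lemma sum_square: "(\<Sum>c\<in>square n. f c) = (\<Sum>i<n. \<Sum>j<n. f (i, j))"
  by (simp add: square_def sum.cartesian_product)

text \<open>
  The sum over a of x(a) times the product of centred indicators is x with its row means and column
  means removed, and these all equal 1/n. The mixture is thus the point on the segment from the
  barycentre to x at the fraction 1/(n-1).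
\<close>

lemma anchor_mixture:
  assumes n: "2 \<le> n" and c: "c \<in> square n"
    and rows: "\<And>i. i < n \<Longrightarrow> (\<Sum>j<n. x (i, j)) = 1" and cols: "\<And>j. j < n \<Longrightarrow> (\<Sum>i<n. x (i, j)) = 1"
  shows "(\<Sum>a\<in>square n. x a / real n * anchor n a c) = 1 / real n + (x c - 1 / real n) / (real n - 1)"
proof -
  obtain p q where pq: "c = (p, q)" "p < n" "q < n" using c by (auto simp: square_def)
  have "(\<Sum>i<n. \<Sum>j<n. x (i, j) * (of_bool (p = i) - 1 / real n) * (of_bool (q = j) - 1 / real n))
    = (\<Sum>i<n. (of_bool (p = i) - 1 / real n) * (\<Sum>j<n. x (i, j) * of_bool (q = j) - x (i, j) / real n))"
    by (simp add: sum_distrib_left algebra_simps)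
  also have "\<dots> = (\<Sum>i<n. (of_bool (p = i) - 1 / real n) * (x (i, q) - 1 / real n))"
  proof (intro sum.cong refl)
    fix i assume "i \<in> {..<n}"
    moreover have "(\<Sum>j<n. x (i, j) * of_bool (q = j)) = x (i, q)"
      using pq(3) by (simp add: of_bool_def if_distrib cong: if_cong)
    ultimately show "(of_bool (p = i) - 1 / real n) * (\<Sum>j<n. x (i, j) * of_bool (q = j) - x (i, j) / real n)
        = (of_bool (p = i) - 1 / real n) * (x (i, q) - 1 / real n)"
      using rows[of i] by (simp add: sum_subtractf sum_divide_distrib[symmetric])
  qed
  also have "\<dots> = (\<Sum>i<n. of_bool (p = i) * (x (i, q) - 1 / real n)) - (1 / real n) * ((\<Sum>i<n. x (i, q)) - 1)"
    using n by (simp add: left_diff_distrib sum_subtractf sum_distrib_left[symmetric] sum_divide_distrib[symmetric])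
  also have "\<dots> = x c - 1 / real n"
    using pq cols by (simp add: of_bool_def if_distrib if_distribR cong: if_cong)
  finally have main: "(\<Sum>i<n. \<Sum>j<n. x (i, j) * (of_bool (p = i) - 1 / real n) * (of_bool (q = j) - 1 / real n))
    = x c - 1 / real n" .
  have "(\<Sum>a\<in>square n. x a / real n * anchor n a c)
    = (\<Sum>i<n. \<Sum>j<n. x (i, j) / real n * (1 / real n)
        + 1 / (real n - 1) * (x (i, j) * (of_bool (p = i) - 1 / real n) * (of_bool (q = j) - 1 / real n)))"
    unfolding sum_square using n by (intro sum.cong refl) (simp add: anchor_def pq distrib_left)
  also have "\<dots> = (\<Sum>i<n. \<Sum>j<n. x (i, j)) / real n * (1 / real n) + 1 / (real n - 1) * (x c - 1 / real n)"
    unfolding main[symmetric] by (simp only: sum.distrib sum_distrib_left sum_distrib_right sum_divide_distrib)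
  also have "\<dots> = 1 / real n + (x c - 1 / real n) / (real n - 1)"
    using n rows by simp
  finally show ?thesis .
qed

text \<open>
  The barycentre is the anchor mixture with the weights of the barycentre itself, so the
  sampling bound applies to it as well as to the mixture that belongs to x.
\<close>

lemma anchor_means_approximate:
  assumes n: "2 \<le> n" and k: "2 \<le> k"
    and upper: "\<And>x. doubly_stochastic n x \<Longrightarrow> quad (square n) M l x \<le> S"
    and lower: "\<And>\<tau>. (\<And>m. \<tau> m \<in> square n) \<Longrightarrow>
      \<beta> \<le> quad (square n) M l (\<lambda>c. (\<Sum>m<k. anchor n (\<tau> m) c) / real k)"
    and x: "doubly_stochastic n x"
  shows "(1 - 1 / real k) * (S - quad (square n) M l x) \<le> (2 * real n - 3)\<^sup>2 * (S - \<beta>)"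
proof -
  let ?q = "quad (square n) M l"
  have mix: "(1 - 1 / real k) * (S - ?q (\<lambda>c. 1 / real n + (y c - 1 / real n) / (real n - 1))) \<le> S - \<beta>
    \<and> doubly_stochastic n (\<lambda>c. \<Sum>a\<in>square n. y a / real n * anchor n a c)"
    if y: "doubly_stochastic n y" for y
  proof
    have w: "(\<Sum>a\<in>square n. y a / real n) = 1" "\<And>a. a \<in> square n \<Longrightarrow> 0 \<le> y a / real n"
      using y n by (auto simp: sum_square doubly_stochastic_def sum_divide_distrib[symmetric])
        (auto simp: square_def)
    have fin: "finite (square n)" by (simp add: square_def)
    have anc: "doubly_stochastic n (anchor n a)" if "a \<in> square n" for a
      using that n by (auto simp: square_def intro: doubly_stochastic_anchor)
    have "?q (\<lambda>c. \<Sum>a\<in>square n. y a / real n * anchor n a c)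
        = ?q (\<lambda>c. 1 / real n + (y c - 1 / real n) / (real n - 1))"
      using y n by (intro quad_cong anchor_mixture) (auto simp: doubly_stochastic_def)
    then show "(1 - 1 / real k) * (S - ?q (\<lambda>c. 1 / real n + (y c - 1 / real n) / (real n - 1))) \<le> S - \<beta>"
      using quad_sampling[OF fin w, where k = k and I = "square n" and M = M and l = l and z = "anchor n"
          and S = S and \<beta> = \<beta>] k anc upper lower by simp
    show "doubly_stochastic n (\<lambda>c. \<Sum>a\<in>square n. y a / real n * anchor n a c)"
      using doubly_stochastic_mixture[OF fin w anc] .
  qed
  define u where "u = (\<lambda>c::nat \<times> nat. 1 / real n)"
  define \<mu> where "\<mu> = (\<lambda>c. 1 / real n + (x c - 1 / real n) / (real n - 1))"
  have u: "doubly_stochastic n u" using n by (simp add: u_def doubly_stochastic_def)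
  define \<delta> where "\<delta> = (S - \<beta>) / (1 - 1 / real k)"
  have kpos: "0 < 1 - 1 / real k" using k by simp
  have hu: "S - ?q u \<le> \<delta>"
    using mix[OF u] kpos by (simp add: u_def \<delta>_def pos_le_divide_eq mult.commute)
  have h\<mu>: "S - ?q \<mu> \<le> \<delta>"
    using mix[OF x] kpos by (simp add: \<mu>_def \<delta>_def pos_le_divide_eq mult.commute)
  have "doubly_stochastic n \<mu>"
  proof -
    have "\<And>c. c \<in> square n \<Longrightarrow> (\<Sum>a\<in>square n. x a / real n * anchor n a c) = \<mu> c"
      using x n unfolding \<mu>_def by (intro anchor_mixture) (auto simp: doubly_stochastic_def)
    then show ?thesis using mix[OF x] by (simp add: doubly_stochastic_def square_def)
  qed
  then have "doubly_stochastic n (\<lambda>c. (\<mu> c + u c) / 2)"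
    using u by (simp add: doubly_stochastic_def sum_divide_distrib[symmetric] sum.distrib)
  then have hm: "?q (\<lambda>c. (\<mu> c + u c) / 2) \<le> S" by (rule upper)
  define s where "s = real n - 1"
  have s: "1 \<le> s" using n by (simp add: s_def)
  have "?q x = ?q (\<lambda>c. s * \<mu> c - (s - 1) * u c)"
  proof (rule quad_cong)
    fix c :: "nat \<times> nat"
    show "x c = s * \<mu> c - (s - 1) * u c"
      using s n unfolding \<mu>_def u_def s_def by (simp add: field_simps)
  qed
  also have "\<dots> = s * (2 * s - 1) * ?q \<mu> + (s - 1) * (2 * s - 1) * ?q u
      - 4 * s * (s - 1) * ?q (\<lambda>c. (\<mu> c + u c) / 2)"
    by (rule quad_three_points)
  finally have "S - ?q x = s * (2 * s - 1) * (S - ?q \<mu>) + (s - 1) * (2 * s - 1) * (S - ?q u)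
      - 4 * s * (s - 1) * (S - ?q (\<lambda>c. (\<mu> c + u c) / 2))"
    by (simp add: algebra_simps power2_eq_square)
  also have "\<dots> \<le> s * (2 * s - 1) * \<delta> + (s - 1) * (2 * s - 1) * \<delta> - 0"
    using s hm hu h\<mu> by (intro diff_mono add_mono mult_left_mono mult_nonneg_nonneg) auto
  also have "\<dots> = (2 * real n - 3)\<^sup>2 * \<delta>"
    by (simp add: s_def power2_eq_square algebra_simps)
  finally have "(1 - 1 / real k) * (S - ?q x) \<le> (1 - 1 / real k) * ((2 * real n - 3)\<^sup>2 * \<delta>)"
    using kpos by (intro mult_left_mono) auto
  also have "\<dots> = (2 * real n - 3)\<^sup>2 * (S - \<beta>)"
  proof -
    have "(1 - 1 / real k) * \<delta> = S - \<beta>" unfolding \<delta>_def using kpos k by simp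
    then show ?thesis by (metis mult.left_commute)
  qed
  finally show ?thesis .
qed

section \<open>Comparison with g\<close>

text \<open>
  With r the rounded number in g, the bound amounts to
  $2\sqrt{8/7}\,(2n-3) \le n\sqrt r + n - 2$; the proof replaces $\sqrt{8/7}$ by the slightly larger
  $15/14$. For n = 5 equality would hold with 12/5 in place of $\sqrt 6$, so this case leaves
  hardly any room; for larger n the growth of r dominates.
\<close>

lemma asqp_g_bounds:
  assumes n: "2 \<le> n"
  shows "0 < asqp_g n" "asqp_g n * (2 * real n - 3)\<^sup>2 \<le> 7 / 8"
proof -
  define r where "r = \<lceil>(sqrt (8 * (real n)\<^sup>2 + 17) - 3) / 2\<rceil>"
  \<comment> \<open>Without square roots: the ceiling is at least j as soon as its argument exceeds j - 1.\<close>
  have rI: "real_of_int j \<le> of_int r" if "(2 * real_of_int j + 1)\<^sup>2 < 8 * (real n)\<^sup>2 + 17" "0 \<le> j" for j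
  proof -
    have "2 * real_of_int j + 1 < sqrt (8 * (real n)\<^sup>2 + 17)"
      using that by (intro real_less_rsqrt) auto
    then have "real_of_int (j - 1) < (sqrt (8 * (real n)\<^sup>2 + 17) - 3) / 2" by simp
    then have "j - 1 < r" unfolding r_def by (simp add: less_ceiling_iff)
    then show ?thesis by simp
  qed
  have main: "15 / 7 * (2 * real n - 3) \<le> real n * sqrt (of_int r) + real n - 2"
  proof -
    \<comment> \<open>In each case j is a lower bound of r and t a rational lower bound of its square root.\<close>
    have big: "r \<ge> j \<Longrightarrow> 0 \<le> t \<Longrightarrow> t\<^sup>2 \<le> of_int j \<Longrightarrow> real n * t \<le> real n * sqrt (of_int r)" for j t
      by (intro mult_left_mono real_le_rsqrt) (auto intro: order_trans)
    consider "n = 2" | "n = 3" | "n = 4" | "n = 5" | "n = 6" | "7 \<le> n" "n \<le> 15" | "16 \<le> n"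
      using n by linarith
    then show ?thesis
    proof cases
      case 1
      have "r \<ge> 2" using rI[of 2] 1 by simp
      then show ?thesis using big[of 2 "7/5"] 1 by (simp add: power2_eq_square)
    next
      case 2
      have "r \<ge> 4" using rI[of 4] 2 by simp
      then show ?thesis using big[of 4 2] 2 by (simp add: power2_eq_square)
    next
      case 3
      have "r \<ge> 5" using rI[of 5] 3 by simp
      then show ?thesis using big[of 5 "11/5"] 3 by (simp add: power2_eq_square)
    next
      case 4
      have "r \<ge> 6" using rI[of 6] 4 by simp
      then show ?thesis using big[of 6 "12/5"] 4 by (simp add: power2_eq_square)
    next
      case 5
      have "r \<ge> 8" using rI[of 8] 5 by simp
      then show ?thesis using big[of 8 "14/5"] 5 by (simp add: power2_eq_square)
    next
      case 6
      have "(7::real)\<^sup>2 \<le> (real n)\<^sup>2" using 6 by (intro power_mono) auto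
      then have "r \<ge> 9" using rI[of 9] by simp
      then have "real n * 3 \<le> real n * sqrt (of_int r)" by (intro big[of 9]) auto
      moreover have "15 / 7 * (2 * real n - 3) \<le> real n * 3 + real n - 2" using 6 by simp
      ultimately show ?thesis by linarith
    next
      case 7
      have "(16::real)\<^sup>2 \<le> (real n)\<^sup>2" using 7 by (intro power_mono) auto
      then have "r \<ge> 16" using rI[of 16] by simp
      then have "real n * 4 \<le> real n * sqrt (of_int r)" by (intro big[of 16]) auto
      moreover have "15 / 7 * (2 * real n - 3) \<le> real n * 4 + real n - 2" using 7 by simp
      ultimately show ?thesis by linarith
    qed
  qed
  define D where "D = real n * sqrt (of_int r) + real n - 2"
  have pos: "0 < 15 / 7 * (2 * real n - 3)" using n by simp
  have "asqp_g n = 4 / D\<^sup>2"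
  proof -
    have "real n * (sqrt (of_int r) + 1 - 2 / real n) = D" 
      using n by (simp add: D_def field_simps)
    then show ?thesis
      unfolding asqp_g_def r_def[symmetric] power_mult_distrib[symmetric] by simp
  qed
  moreover have "(15 / 7 * (2 * real n - 3))\<^sup>2 \<le> D\<^sup>2"
    using main pos unfolding D_def by (intro power_mono) auto
  moreover have "0 < D" using main pos unfolding D_def by linarith
  moreover have "(15 / 7 * (2 * real n - 3))\<^sup>2 = 225 / 49 * (2 * real n - 3)\<^sup>2"
    by (simp only: power_mult_distrib) (simp add: power2_eq_square)
  ultimately have g: "asqp_g n = 4 / D\<^sup>2" "0 < D\<^sup>2" "225 / 49 * (2 * real n - 3)\<^sup>2 \<le> D\<^sup>2"
    by simp_all
  moreover have "0 \<le> (2 * real n - 3)\<^sup>2" by simp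
  ultimately have "4 * (2 * real n - 3)\<^sup>2 \<le> 7 / 8 * D\<^sup>2" by linarith
  then show "0 < asqp_g n" "asqp_g n * (2 * real n - 3)\<^sup>2 \<le> 7 / 8"
    using g(1,2) by (simp_all add: pos_divide_le_eq)
qed

section \<open>Total correctness with time bounds\<close>

definition runs_within :: "ram_prog \<Rightarrow> ram_state \<Rightarrow> nat \<Rightarrow> (ram_state \<Rightarrow> bool) \<Rightarrow> bool" where
  "runs_within c s T Q \<longleftrightarrow> (\<exists>t s'. ram_exec c s t s' \<and> t \<le> T \<and> Q s')"

lemma runs_mono:
  assumes "runs_within c s T P" "T \<le> T'" "\<And>s'. P s' \<Longrightarrow> Q s'"
  shows "runs_within c s T' Q"
  using assms unfolding runs_within_def by (meson le_trans)

lemma runs_Skip: "Q s \<Longrightarrow> runs_within Skip s 1 Q"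
  unfolding runs_within_def using ram_exec.Skip by blast

lemma runs_SetReg: "Q ((fst s)(r := nval a s), snd s) \<Longrightarrow> runs_within (SetReg r a) s 1 Q"
  unfolding runs_within_def using ram_exec.SetReg by blast

lemma runs_SetCell: "Q (fst s, (snd s)(nval a s := rval e s)) \<Longrightarrow> runs_within (SetCell a e) s 1 Q"
  unfolding runs_within_def using ram_exec.SetCell by blast

lemma runs_Seq:
  assumes "runs_within c s T P" "\<And>s'. P s' \<Longrightarrow> runs_within d s' U Q"
  shows "runs_within (Seq c d) s (T + U) Q"
  using assms unfolding runs_within_def by (meson add_mono ram_exec.Seq)

lemma runs_If:
  assumes "bval b s \<Longrightarrow> runs_within c s T Q" "\<not> bval b s \<Longrightarrow> runs_within d s T Q"
  shows "runs_within (If b c d) s (T + 1) Q"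
proof (cases "bval b s")
  case True
  then show ?thesis using assms(1) unfolding runs_within_def
    by (meson add_le_mono1 ram_exec.IfTrue)
next
  case False
  then show ?thesis using assms(2) unfolding runs_within_def
    by (meson add_le_mono1 ram_exec.IfFalse)
qed

definition for_loop :: "nat \<Rightarrow> nexp \<Rightarrow> ram_prog \<Rightarrow> ram_prog" where
  "for_loop r e c = Seq (SetReg r (NConst 0))
     (While (NLess (NReg r) e) (Seq c (SetReg r (NAdd (NReg r) (NConst 1)))))"

text \<open>
  The invariant is indexed by the value of the counter and speaks about states in which the counter
  already has that value; the body has to leave the counter alone. Each round costs one test and one
  increment besides the body, and the first and the last command add 2.
\<close>

lemma runs_for_loop:
  assumes init: "I 0 ((fst s)(r := 0), snd s)"
    and body: "\<And>i s. i < N \<Longrightarrow> fst s r = i \<Longrightarrow> I i s \<Longrightarrow>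
      runs_within c s T (\<lambda>s'. fst s' r = i \<and> I (Suc i) ((fst s')(r := Suc i), snd s'))"
    and bound: "\<And>i s. I i s \<Longrightarrow> nval e s = N"
  shows "runs_within (for_loop r e c) s (N * (T + 2) + 2) (I N)"
proof -
  let ?w = "While (NLess (NReg r) e) (Seq c (SetReg r (NAdd (NReg r) (NConst 1))))"
  have loop: "runs_within ?w s ((N - i) * (T + 2) + 1) (I N)"
    if "i \<le> N" "fst s r = i" "I i s" for i s
    using that
  proof (induction "N - i" arbitrary: i s)
    case 0
    then have "i = N" by simp
    have "ram_exec ?w s 1 s"
      using bound[OF 0(4)] 0(3) \<open>i = N\<close> by (intro ram_exec.WhileFalse) simp
    then show ?case
      using 0(4) \<open>i = N\<close> unfolding runs_within_def by (intro exI[of _ 1] exI[of _ s]) simp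
  next
    case (Suc d)
    then have i: "i < N" by simp
    obtain t s1 where t: "ram_exec c s t s1" "t \<le> T" "fst s1 r = i"
      "I (Suc i) ((fst s1)(r := Suc i), snd s1)"
      using body[OF i] Suc.prems unfolding runs_within_def by blast
    let ?s2 = "((fst s1)(r := Suc i), snd s1)"
    have step: "ram_exec (Seq c (SetReg r (NAdd (NReg r) (NConst 1)))) s (t + 1) ?s2"
      using ram_exec.Seq[OF t(1) ram_exec.SetReg, of r "NAdd (NReg r) (NConst 1)"] t(3) by simp
    have "runs_within ?w ?s2 ((N - Suc i) * (T + 2) + 1) (I N)"
      using Suc.hyps(1)[of "Suc i" ?s2] Suc.hyps(2) i t(4) by auto
    then obtain u s3 where u: "ram_exec ?w ?s2 u s3" "u \<le> (N - Suc i) * (T + 2) + 1" "I N s3"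
      unfolding runs_within_def by blast
    have "bval (NLess (NReg r) e) s" using bound[OF Suc.prems(3)] Suc.prems(2) i by simp
    then have "ram_exec ?w s (t + 1 + u + 1) s3" using step u(1) by (rule ram_exec.WhileTrue)
    moreover have "t + 1 + u + 1 \<le> (N - i) * (T + 2) + 1"
    proof -
      have "N - i = Suc (N - Suc i)" using i by simp
      then show ?thesis using t(2) u(2) by simp
    qed
    ultimately show ?case using u(3) unfolding runs_within_def by blast
  qed
  have "runs_within (for_loop r e c) s (1 + (N * (T + 2) + 1)) (I N)"
    unfolding for_loop_def
  proof (rule runs_Seq)
    show "runs_within (SetReg r (NConst 0)) s 1 (\<lambda>s'. fst s' r = 0 \<and> I 0 s')"
      using init by (intro runs_SetReg) simp
    show "runs_within ?w s' (N * (T + 2) + 1) (I N)" if "fst s' r = 0 \<and> I 0 s'" for s'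
      using loop[of 0 s'] that by simp
  qed
  then show ?thesis by simp
qed

section \<open>Programs that compute nested sums\<close>

text \<open>
  The part of the state that persists through the whole search: the two parameters and the input.
\<close>

definition ready :: "nat \<Rightarrow> nat \<Rightarrow> (nat \<Rightarrow> real) \<Rightarrow> ram_state \<Rightarrow> bool" where
  "ready L n inp s \<longleftrightarrow> fst s 0 = L \<and> fst s 1 = n \<and> (\<forall>c<L. snd s c = inp c)"

definition agree_off :: "nat set \<Rightarrow> (nat \<Rightarrow> nat) \<Rightarrow> (nat \<Rightarrow> nat) \<Rightarrow> bool" where
  "agree_off D \<rho> \<rho>' \<longleftrightarrow> (\<forall>r. r \<notin> D \<longrightarrow> \<rho> r = \<rho>' r)"

lemma ready_step:
  assumes "ready L n inp s \<and> (\<forall>r\<in>E. fst s r < n)" "D \<inter> (E \<union> {0, 1}) = {}"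
    and "agree_off D (fst s) (fst s') \<and> snd s' = (snd s)(d := w)" "L \<le> d"
  shows "ready L n inp s' \<and> (\<forall>r\<in>E. fst s' r < n)"
proof -
  have "fst s' r = fst s r" if "r \<in> E \<union> {0, 1}" for r
    using assms(2,3) that unfolding agree_off_def by (metis disjoint_iff)
  then show ?thesis using assms(1,3,4) by (auto simp: ready_def)
qed

text \<open>
  Nested sums are computed by nested loops that add to one cell d behind the input. The relation
  below composes: a loop around an accumulating program accumulates the sum over its counter.
\<close>

locale ram_summation =
  fixes L n :: nat and inp :: "nat \<Rightarrow> real" and d :: nat
  assumes target: "L \<le> d"
begin

text \<open>
  D contains the registers that c may overwrite and E those that hold indices below n, without which
  addresses computed from them could point outside the input. The added value v depends on registers
  outside D only, so that sequential composition adds the values.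
\<close>

definition accumulates ::
    "nat set \<Rightarrow> nat set \<Rightarrow> ((nat \<Rightarrow> nat) \<Rightarrow> real) \<Rightarrow> nat \<Rightarrow> ram_prog \<Rightarrow> bool" where
  "accumulates E D v T c \<longleftrightarrow> D \<inter> (E \<union> {0, 1}) = {} \<and>
     (\<forall>\<rho> \<rho>'. agree_off D \<rho> \<rho>' \<longrightarrow> v \<rho> = v \<rho>') \<and>
     (\<forall>s. ready L n inp s \<and> (\<forall>r\<in>E. fst s r < n) \<longrightarrow>
       runs_within c s T (\<lambda>s'. agree_off D (fst s) (fst s') \<and>
         snd s' = (snd s)(d := snd s d + v (fst s))))"

lemma accumulates_SetCell:
  assumes "D \<inter> (E \<union> {0, 1}) = {}" "\<And>\<rho> \<rho>'. agree_off D \<rho> \<rho>' \<Longrightarrow> v \<rho> = v \<rho>'"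
    and "\<And>s. ready L n inp s \<Longrightarrow> nval a s = d"
    and "\<And>s. ready L n inp s \<Longrightarrow> \<forall>r\<in>E. fst s r < n \<Longrightarrow> rval e s = v (fst s)"
  shows "accumulates E D v 1 (SetCell a (RAdd (RCell a) e))"
  unfolding accumulates_def
proof (intro conjI allI impI)
  fix s assume "ready L n inp s \<and> (\<forall>r\<in>E. fst s r < n)"
  then show "runs_within (SetCell a (RAdd (RCell a) e)) s 1 (\<lambda>s'. agree_off D (fst s) (fst s') \<and>
      snd s' = (snd s)(d := snd s d + v (fst s)))"
    by (intro runs_SetCell) (simp add: agree_off_def assms(3,4))
qed (use assms(1,2) in auto)

lemma accumulates_Seq:
  assumes "accumulates E D v T c" "accumulates E D w U c'"
  shows "accumulates E D (\<lambda>\<rho>. v \<rho> + w \<rho>) (T + U) (Seq c c')"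
  unfolding accumulates_def
proof (intro conjI allI impI)
  show "D \<inter> (E \<union> {0, 1}) = {}" using assms(1) by (simp add: accumulates_def)
  show "v \<rho> + w \<rho> = v \<rho>' + w \<rho>'" if "agree_off D \<rho> \<rho>'" for \<rho> \<rho>'
    using assms that unfolding accumulates_def by metis
  fix s assume s: "ready L n inp s \<and> (\<forall>r\<in>E. fst s r < n)"
  show "runs_within (Seq c c') s (T + U) (\<lambda>s'. agree_off D (fst s) (fst s') \<and>
     snd s' = (snd s)(d := snd s d + (v (fst s) + w (fst s))))"
  proof (rule runs_Seq)
    show "runs_within c s T (\<lambda>s'. agree_off D (fst s) (fst s') \<and>
         snd s' = (snd s)(d := snd s d + v (fst s)))"
      using assms(1) s unfolding accumulates_def by blast
    fix s' assume s': "agree_off D (fst s) (fst s') \<and> snd s' = (snd s)(d := snd s d + v (fst s))"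
    have "D \<inter> (E \<union> {0, 1}) = {}" using assms(1) by (simp add: accumulates_def)
    then have "ready L n inp s' \<and> (\<forall>r\<in>E. fst s' r < n)"
      using ready_step[OF s _ _ target] s' by blast
    then have "runs_within c' s' U (\<lambda>s''. agree_off D (fst s') (fst s'') \<and>
         snd s'' = (snd s')(d := snd s' d + w (fst s')))"
      using assms(2) unfolding accumulates_def by blast
    moreover have "w (fst s') = w (fst s)"
      using assms(2) s' unfolding accumulates_def by metis
    ultimately show "runs_within c' s' U (\<lambda>s'. agree_off D (fst s) (fst s') \<and>
     snd s' = (snd s)(d := snd s d + (v (fst s) + w (fst s))))"
      using s' by (elim runs_mono) (auto simp: agree_off_def)
  qed
qed

lemma accumulates_for_loop:
  assumes c: "accumulates (insert r E) D v T c" and r: "r \<notin> E" "r \<noteq> 0" "r \<noteq> 1"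
  shows "accumulates E (insert r D) (\<lambda>\<rho>. \<Sum>i<n. v (\<rho>(r := i))) (n * (T + 2) + 2)
    (for_loop r (NReg 1) c)"
  unfolding accumulates_def
proof (intro conjI allI impI)
  have D: "D \<inter> (insert r E \<union> {0, 1}) = {}" using c by (simp add: accumulates_def)
  then show dis: "insert r D \<inter> (E \<union> {0, 1}) = {}" using r by auto
  have vcong: "v \<rho> = v \<rho>'" if "agree_off D \<rho> \<rho>'" for \<rho> \<rho>'
    using c that unfolding accumulates_def by blast
  show "(\<Sum>i<n. v (\<rho>(r := i))) = (\<Sum>i<n. v (\<rho>'(r := i)))" if "agree_off (insert r D) \<rho> \<rho>'" for \<rho> \<rho>'
    using that by (intro sum.cong refl vcong) (auto simp: agree_off_def)
  fix s assume s: "ready L n inp s \<and> (\<forall>r\<in>E. fst s r < n)"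
  define I where "I i s' \<longleftrightarrow> agree_off (insert r D) (fst s) (fst s') \<and>
    snd s' = (snd s)(d := snd s d + (\<Sum>j<i. v ((fst s)(r := j))))" for i s'
  have "runs_within (for_loop r (NReg 1) c) s (n * (T + 2) + 2) (I n)"
  proof (rule runs_for_loop[where I = I and N = n])
    show "I 0 ((fst s)(r := 0), snd s)" by (simp add: I_def agree_off_def)
    show "nval (NReg 1) s' = n" if "I i s'" for i s'
      using that s dis unfolding I_def agree_off_def ready_def by auto
    fix i s' assume i: "i < n" "fst s' r = i" "I i s'"
    have "ready L n inp s' \<and> (\<forall>x\<in>E. fst s' x < n)"
      using ready_step[OF _ dis _ target] s i(3) unfolding I_def by blast
    then have "ready L n inp s' \<and> (\<forall>x\<in>insert r E. fst s' x < n)"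
      using i(1,2) by simp
    then have "runs_within c s' T (\<lambda>s''. agree_off D (fst s') (fst s'') \<and>
         snd s'' = (snd s')(d := snd s' d + v (fst s')))"
      using c unfolding accumulates_def by blast
    moreover have "v (fst s') = v ((fst s)(r := i))"
      using i unfolding I_def by (intro vcong) (auto simp: agree_off_def)
    ultimately show "runs_within c s' T (\<lambda>s'. fst s' r = i \<and> I (Suc i) ((fst s')(r := Suc i), snd s'))"
      using i D by (elim runs_mono) (auto simp: I_def agree_off_def)
  qed
  then show "runs_within (for_loop r (NReg 1) c) s (n * (T + 2) + 2)
     (\<lambda>s'. agree_off (insert r D) (fst s) (fst s') \<and>
         snd s' = (snd s)(d := snd s d + (\<Sum>i<n. v ((fst s)(r := i)))))"
    by (rule runs_mono) (simp_all add: I_def)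
qed

end

section \<open>The program\<close>

text \<open>
  Register 0 keeps the length of the input and register 1 the order n; registers 2 to 5 are indices
  of sums. The tuple under examination, given by 8 row and 8 column indices in alternation, lies
  in registers 6 to 21, the best tuple so far in registers 22 to 37. The best tuple needs no
  initialization, since a register that was never written denotes the valid index 0. The first two
  cells behind the input receive the two values of f that are compared.
\<close>

text \<open>
  A test for equality as a number, by truncated subtraction.
\<close>

definition eq_exp :: "nexp \<Rightarrow> nexp \<Rightarrow> nexp" where
  "eq_exp a b = NSub (NSub (NConst 1) (NSub a b)) (NSub b a)"

lemma nval_eq_exp: "nval (eq_exp a b) s = of_bool (nval a s = nval b s)"
  by (auto simp: eq_exp_def)

definition order_exp :: rexp where "order_exp = ROfNat (NReg 1)"

definition centred_exp :: "nexp \<Rightarrow> nexp \<Rightarrow> rexp" where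
  "centred_exp a b = RSub (ROfNat (eq_exp a b)) (RDiv (ROfNat (NConst 1)) order_exp)"

definition anchor_exp :: "nexp \<Rightarrow> nexp \<Rightarrow> nexp \<Rightarrow> nexp \<Rightarrow> rexp" where
  "anchor_exp i j p q = RAdd (RDiv (ROfNat (NConst 1)) order_exp)
     (RMul (RMul (RDiv order_exp (RSub order_exp (ROfNat (NConst 1)))) (centred_exp p i))
        (centred_exp q j))"

fun anchor_sum_exp :: "nat \<Rightarrow> nat \<Rightarrow> nexp \<Rightarrow> nexp \<Rightarrow> rexp" where
  "anchor_sum_exp r 0 p q = ROfNat (NConst 0)"
| "anchor_sum_exp r (Suc m) p q = RAdd (anchor_sum_exp r m p q)
     (anchor_exp (NReg (r + 2 * m)) (NReg (r + 2 * m + 1)) p q)"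

definition blend_exp :: "nat \<Rightarrow> nexp \<Rightarrow> nexp \<Rightarrow> rexp" where
  "blend_exp r p q = RDiv (anchor_sum_exp r 8 p q) (ROfNat (NConst 8))"

text \<open>
  The mean of the 8 anchors whose positions are the consecutive pairs of entries of the tuple.
\<close>

definition blend :: "nat \<Rightarrow> (nat \<Rightarrow> nat) \<Rightarrow> nat \<times> nat \<Rightarrow> real" where
  "blend n \<tau> c = (\<Sum>m<8. anchor n (\<tau> (2 * m), \<tau> (2 * m + 1)) c) / 8"

lemma blend_cong: "(\<And>j. j < 16 \<Longrightarrow> \<tau> j = \<sigma> j) \<Longrightarrow> blend n \<tau> = blend n \<sigma>"
  by (auto simp: blend_def fun_eq_iff intro!: sum.cong arg_cong2[where f = "\<lambda>x y. anchor n (x, y) _"])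

lemma rval_anchor_sum_exp:
  "rval (anchor_sum_exp r m p q) s
    = (\<Sum>k<m. anchor (fst s 1) (fst s (r + 2 * k), fst s (r + (2 * k + 1))) (nval p s, nval q s))"
  by (induction m) (simp_all add: anchor_exp_def centred_exp_def order_exp_def nval_eq_exp anchor_def)

lemma rval_blend_exp:
  "rval (blend_exp r p q) s = blend (fst s 1) (\<lambda>j. fst s (r + j)) (nval p s, nval q s)"
  by (simp add: blend_exp_def blend_def rval_anchor_sum_exp del: anchor_sum_exp.simps)

definition flat :: "nat \<Rightarrow> nat \<times> nat \<Rightarrow> nat" where "flat n c = fst c * n + snd c"

lemma flat_less: "p < n \<Longrightarrow> q < n \<Longrightarrow> p * n + q < n * (n::nat)"
proof -
  assume "p < n" "q < n"
  then have "p * n + q < Suc p * n" by simp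
  also have "\<dots> \<le> n * n" using \<open>p < n\<close> by (intro mult_le_mono1) simp
  finally show ?thesis .
qed

definition cost :: "nat \<Rightarrow> real mat \<Rightarrow> real vec \<Rightarrow> (nat \<times> nat \<Rightarrow> real) \<Rightarrow> real" where
  "cost n A b = quad (square n) (\<lambda>c d. A $$ (flat n c, flat n d)) (\<lambda>c. b $ flat n c)"

lemma cost_eq:
  "cost n A b x = (\<Sum>p<n. \<Sum>q<n. 2 * b $ (p * n + q) * x (p, q)
     + (\<Sum>p'<n. \<Sum>q'<n. A $$ (p * n + q, p' * n + q') * x (p, q) * x (p', q')))"
  unfolding cost_def quad_def sum_square
  by (simp add: sum.distrib flat_def sum_distrib_left mult.assoc)

definition flat_exp :: "nexp \<Rightarrow> nexp \<Rightarrow> nexp" where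
  "flat_exp p q = NAdd (NMul p (NReg 1)) q"

definition square_exp :: nexp where "square_exp = NMul (NReg 1) (NReg 1)"

definition mat_exp :: "nexp \<Rightarrow> nexp \<Rightarrow> nexp \<Rightarrow> nexp \<Rightarrow> rexp" where
  "mat_exp p q p' q' = RCell (NAdd (NConst 1) (NAdd (NMul (flat_exp p q) square_exp) (flat_exp p' q')))"

definition vec_exp :: "nexp \<Rightarrow> nexp \<Rightarrow> rexp" where
  "vec_exp p q = RCell (NAdd (NConst 1) (NAdd (NMul square_exp square_exp) (flat_exp p q)))"

definition add_to_cell :: "nexp \<Rightarrow> rexp \<Rightarrow> ram_prog" where
  "add_to_cell a e = SetCell a (RAdd (RCell a) e)"

definition scratch :: "nat \<Rightarrow> nexp" where "scratch k = NAdd (NReg 0) (NConst k)"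

text \<open>
  Computes f at the mean given by the tuple that starts in register r. The entries of the mean are
  not stored: each is a closed expression in the index registers.
\<close>

definition evaluate :: "nat \<Rightarrow> nat \<Rightarrow> ram_prog" where
  "evaluate r k = Seq (SetCell (scratch k) (ROfNat (NConst 0)))
    (for_loop 2 (NReg 1) (for_loop 3 (NReg 1) (Seq
      (add_to_cell (scratch k)
        (RMul (RMul (ROfNat (NConst 2)) (vec_exp (NReg 2) (NReg 3))) (blend_exp r (NReg 2) (NReg 3))))
      (for_loop 4 (NReg 1) (for_loop 5 (NReg 1)
        (add_to_cell (scratch k)
          (RMul (RMul (mat_exp (NReg 2) (NReg 3) (NReg 4) (NReg 5)) (blend_exp r (NReg 2) (NReg 3)))
            (blend_exp r (NReg 4) (NReg 5)))))))))"

definition evaluate_time :: "nat \<Rightarrow> nat" where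
  "evaluate_time n = 1 + (n * (n * (1 + (n * (n * (1 + 2) + 2 + 2) + 2) + 2) + 2 + 2) + 2)"

lemma nth_concat_blocks:
  assumes "\<And>i. i < k \<Longrightarrow> length (f i) = m" "c < k" "d < m"
  shows "concat (map f [0..<k]) ! (c * m + d) = f c ! d \<and> length (concat (map f [0..<k])) = k * m"
  using assms
proof (induction k)
  case 0
  then show ?case by simp
next
  case (Suc k)
  have len: "length (concat (map f [0..<k])) = k * m"
  proof -
    have "map (length \<circ> f) [0..<k] = map (\<lambda>_. m) [0..<k]" using Suc.prems(1) by simp
    then show ?thesis by (simp add: length_concat map_replicate_const sum_list_replicate)
  qed
  show ?case
  proof (cases "c < k")
    case True
    have "c * m + d < k * m"
    proof -
      have "c * m + d < Suc c * m" using Suc.prems(3) by simp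
      also have "\<dots> \<le> k * m" using True by (intro mult_le_mono1) simp
      finally show ?thesis .
    qed
    then show ?thesis using Suc len True by (simp add: nth_append)
  next
    case False
    then have "c = k" using Suc.prems(2) by simp
    then show ?thesis using Suc.prems len by (simp add: nth_append)
  qed
qed

locale asqp_instance =
  fixes n :: nat and A :: "real mat" and b :: "real vec"
  assumes n: "2 \<le> n" and A: "A \<in> carrier_mat (n\<^sup>2) (n\<^sup>2)" and b: "b \<in> carrier_vec (n\<^sup>2)"
begin

abbreviation "code \<equiv> asqp_encode (n, A, b)"
abbreviation "len \<equiv> length code"
abbreviation "holds_input \<equiv> ready len n (\<lambda>c. code ! c)"

lemma encoded_mat:
  assumes "c < n * n" "d < n * n"
  shows "concat (mat_to_list A) ! (c * (n * n) + d) = A $$ (c, d)"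
    "length (concat (mat_to_list A)) = n * n * (n * n)"
proof -
  have dims: "dim_row A = n * n" "dim_col A = n * n" using A by (auto simp: power2_eq_square)
  show "concat (mat_to_list A) ! (c * (n * n) + d) = A $$ (c, d)"
    "length (concat (mat_to_list A)) = n * n * (n * n)"
    using nth_concat_blocks[of "n * n" "\<lambda>i. map (\<lambda>j. A $$ (i, j)) [0..<n * n]" "n * n" c d] assms
    unfolding mat_to_list_def dims by simp_all
qed

lemma len_eq: "len = 1 + n * n * (n * n) + n * n"
  using encoded_mat(2)[of 0 0] n b by (simp add: asqp_encode_def power2_eq_square)

lemma code_order: "code ! 0 = real n"
  by (simp add: asqp_encode_def)

lemma code_mat:
  assumes "c < n * n" "d < n * n"
  shows "code ! (1 + (c * (n * n) + d)) = A $$ (c, d)" "1 + (c * (n * n) + d) < len"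
proof -
  have "c * (n * n) + d < n * n * (n * n)" using flat_less assms by blast
  then show "code ! (1 + (c * (n * n) + d)) = A $$ (c, d)" "1 + (c * (n * n) + d) < len"
    using encoded_mat[OF assms] len_eq by (simp_all add: asqp_encode_def nth_append)
qed

lemma code_vec:
  assumes "c < n * n"
  shows "code ! (1 + (n * n * (n * n) + c)) = b $ c" "1 + (n * n * (n * n) + c) < len"
proof -
  show "code ! (1 + (n * n * (n * n) + c)) = b $ c"
    using encoded_mat[OF assms assms] assms b
    by (simp add: asqp_encode_def nth_append power2_eq_square list_of_vec_index)
  show "1 + (n * n * (n * n) + c) < len" using assms len_eq by simp
qed

lemma runs_evaluate:
  assumes s: "holds_input s" and r: "6 \<le> r"
  shows "runs_within (evaluate r k) s (evaluate_time n)
    (\<lambda>s'. agree_off {2, 3, 4, 5} (fst s) (fst s') \<and>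
      snd s' = (snd s)(len + k := cost n A b (blend n (\<lambda>j. fst s (r + j)))))"
proof -
  interpret ram_summation len n "\<lambda>c. code ! c" "len + k"
    by unfold_locales simp
  let ?x = "\<lambda>\<rho>. blend n (\<lambda>j. \<rho> (r + j))"
  have x_cong: "?x \<rho> = ?x \<rho>'" if "agree_off D \<rho> \<rho>'" "D \<subseteq> {..<6}" for D \<rho> \<rho>'
    using that r by (intro blend_cong) (auto simp: agree_off_def subset_iff)
  define v where "v \<rho> = A $$ (\<rho> 2 * n + \<rho> 3, \<rho> 4 * n + \<rho> 5) * ?x \<rho> (\<rho> 2, \<rho> 3) * ?x \<rho> (\<rho> 4, \<rho> 5)"
    for \<rho> :: "nat \<Rightarrow> nat"
  define w where "w \<rho> = 2 * b $ (\<rho> 2 * n + \<rho> 3) * ?x \<rho> (\<rho> 2, \<rho> 3)" for \<rho> :: "nat \<Rightarrow> nat"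
  have "accumulates {5, 4, 3, 2} {} v 1 (add_to_cell (scratch k)
          (RMul (RMul (mat_exp (NReg 2) (NReg 3) (NReg 4) (NReg 5)) (blend_exp r (NReg 2) (NReg 3)))
            (blend_exp r (NReg 4) (NReg 5))))"
    unfolding add_to_cell_def
  proof (rule accumulates_SetCell)
    fix s assume s: "holds_input s" "\<forall>r\<in>{5, 4, 3, 2}. fst s r < n"
    have "snd s (1 + ((fst s 2 * n + fst s 3) * (n * n) + (fst s 4 * n + fst s 5)))
      = A $$ (fst s 2 * n + fst s 3, fst s 4 * n + fst s 5)"
      using s code_mat[of "fst s 2 * n + fst s 3" "fst s 4 * n + fst s 5"]
      by (simp add: ready_def flat_less)
    then show "rval (RMul (RMul (mat_exp (NReg 2) (NReg 3) (NReg 4) (NReg 5)) (blend_exp r (NReg 2) (NReg 3)))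
            (blend_exp r (NReg 4) (NReg 5))) s = v (fst s)"
      using s(1) by (simp add: mat_exp_def flat_exp_def square_exp_def rval_blend_exp v_def ready_def)
  qed (auto simp: scratch_def ready_def agree_off_def fun_eq_iff[symmetric])
  then have inner: "accumulates {3, 2} {4, 5} (\<lambda>\<rho>. \<Sum>p'<n. \<Sum>q'<n. v (\<rho>(4 := p', 5 := q')))
    (n * (n * (1 + 2) + 2 + 2) + 2)
    (for_loop 4 (NReg 1) (for_loop 5 (NReg 1) (add_to_cell (scratch k)
          (RMul (RMul (mat_exp (NReg 2) (NReg 3) (NReg 4) (NReg 5)) (blend_exp r (NReg 2) (NReg 3)))
            (blend_exp r (NReg 4) (NReg 5))))))"
    by (intro accumulates_for_loop) auto
  have linear: "accumulates {3, 2} {4, 5} w 1 (add_to_cell (scratch k)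
        (RMul (RMul (ROfNat (NConst 2)) (vec_exp (NReg 2) (NReg 3))) (blend_exp r (NReg 2) (NReg 3))))"
    unfolding add_to_cell_def
  proof (rule accumulates_SetCell)
    fix s assume s: "holds_input s" "\<forall>r\<in>{3, 2}. fst s r < n"
    have "snd s (1 + (n * n * (n * n) + (fst s 2 * n + fst s 3))) = b $ (fst s 2 * n + fst s 3)"
      using s code_vec[of "fst s 2 * n + fst s 3"] by (simp add: ready_def flat_less)
    then show "rval (RMul (RMul (ROfNat (NConst 2)) (vec_exp (NReg 2) (NReg 3)))
        (blend_exp r (NReg 2) (NReg 3))) s = w (fst s)"
      using s(1) by (simp add: vec_exp_def flat_exp_def square_exp_def rval_blend_exp w_def ready_def)
  next
    fix \<rho> \<rho>' :: "nat \<Rightarrow> nat" assume agree: "agree_off {4, 5} \<rho> \<rho>'"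
    show "w \<rho> = w \<rho>'"
      unfolding w_def x_cong[OF agree, simplified] using agree by (simp add: agree_off_def)
  qed (auto simp: scratch_def ready_def)
  define total where "total \<rho> = (\<Sum>p<n. \<Sum>q<n. w (\<rho>(2 := p, 3 := q))
    + (\<Sum>p'<n. \<Sum>q'<n. v (\<rho>(2 := p, 3 := q, 4 := p', 5 := q'))))" for \<rho>
  define body where "body = for_loop 2 (NReg 1) (for_loop 3 (NReg 1) (Seq
      (add_to_cell (scratch k)
        (RMul (RMul (ROfNat (NConst 2)) (vec_exp (NReg 2) (NReg 3))) (blend_exp r (NReg 2) (NReg 3))))
      (for_loop 4 (NReg 1) (for_loop 5 (NReg 1)
        (add_to_cell (scratch k)
          (RMul (RMul (mat_exp (NReg 2) (NReg 3) (NReg 4) (NReg 5)) (blend_exp r (NReg 2) (NReg 3)))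
            (blend_exp r (NReg 4) (NReg 5))))))))"
  have acc: "accumulates {} {2, 3, 4, 5} total (evaluate_time n - 1) body"
    unfolding total_def body_def evaluate_time_def add_diff_cancel_left'
    by (rule accumulates_for_loop[OF accumulates_for_loop[OF accumulates_Seq[OF linear inner]]]) auto
  have total: "total \<rho> = cost n A b (?x \<rho>)" for \<rho>
  proof -
    have "?x (\<rho>(2 := p, 3 := q)) = ?x \<rho>" "?x (\<rho>(2 := p, 3 := q, 4 := p', 5 := q')) = ?x \<rho>" for p q p' q'
      using r by (auto intro!: blend_cong)
    then show ?thesis unfolding total_def cost_eq w_def v_def by simp
  qed
  have "runs_within (evaluate r k) s (1 + (evaluate_time n - 1))
    (\<lambda>s'. agree_off {2, 3, 4, 5} (fst s) (fst s') \<and> snd s' = (snd s)(len + k := cost n A b (?x (fst s))))"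
    unfolding evaluate_def body_def[symmetric]
  proof (rule runs_Seq)
    show "runs_within (SetCell (scratch k) (ROfNat (NConst 0))) s 1 (\<lambda>s'. s' = (fst s, (snd s)(len + k := 0)))"
      using s by (intro runs_SetCell) (simp add: scratch_def ready_def)
    fix s' assume s': "s' = (fst s, (snd s)(len + k := 0))"
    have "holds_input s'" using s s' by (auto simp: ready_def)
    then have "runs_within body s' (evaluate_time n - 1) (\<lambda>s''. agree_off {2, 3, 4, 5} (fst s') (fst s'') \<and>
         snd s'' = (snd s')(len + k := snd s' (len + k) + total (fst s')))"
      using acc unfolding accumulates_def by blast
    then show "runs_within body s' (evaluate_time n - 1) (\<lambda>s'. agree_off {2, 3, 4, 5} (fst s) (fst s') \<and>
      snd s' = (snd s)(len + k := cost n A b (?x (fst s))))"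
      using s' by (elim runs_mono) (auto simp: total)
  qed
  then show ?thesis by (simp add: evaluate_time_def)
qed

end

fun copy_regs :: "nat \<Rightarrow> ram_prog" where
  "copy_regs 0 = Skip"
| "copy_regs (Suc m) = Seq (copy_regs m) (SetReg (22 + m) (NReg (6 + m)))"

lemma runs_copy_regs:
  assumes "m \<le> 16"
  shows "runs_within (copy_regs m) s (m + 1)
    (\<lambda>s'. s' = (\<lambda>r. if r \<in> {22..<22 + m} then fst s (r - 16) else fst s r, snd s))"
  using assms
proof (induction m)
  case 0
  show ?case unfolding copy_regs.simps by (rule runs_mono[OF runs_Skip[of "\<lambda>s'. s' = s"]]) auto
next
  case (Suc m)
  have "runs_within (copy_regs (Suc m)) s (m + 1 + 1)
    (\<lambda>s'. s' = (\<lambda>r. if r \<in> {22..<22 + Suc m} then fst s (r - 16) else fst s r, snd s))"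
    unfolding copy_regs.simps
  proof (rule runs_Seq)
    show "runs_within (copy_regs m) s (m + 1)
      (\<lambda>s'. s' = (\<lambda>r. if r \<in> {22..<22 + m} then fst s (r - 16) else fst s r, snd s))"
      using Suc by simp
    fix s' assume "s' = (\<lambda>r. if r \<in> {22..<22 + m} then fst s (r - 16) else fst s r, snd s)"
    then show "runs_within (SetReg (22 + m) (NReg (6 + m))) s' 1
      (\<lambda>s'. s' = (\<lambda>r. if r \<in> {22..<22 + Suc m} then fst s (r - 16) else fst s r, snd s))"
      using Suc.prems by (intro runs_SetReg) (auto simp: fun_eq_iff)
  qed
  then show ?case by simp
qed

definition compare :: ram_prog where
  "compare = Seq (evaluate 6 0) (Seq (evaluate 22 1)
     (If (RLess (RCell (scratch 0)) (RCell (scratch 1))) (copy_regs 16) Skip))"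

fun search :: "nat \<Rightarrow> ram_prog" where
  "search 0 = compare"
| "search (Suc m) = for_loop (6 + m) (NReg 1) (search m)"

fun search_time :: "nat \<Rightarrow> nat \<Rightarrow> nat" where
  "search_time n 0 = evaluate_time n + (evaluate_time n + 18)"
| "search_time n (Suc m) = n * (search_time n m + 2) + 2"

definition read_order :: ram_prog where
  "read_order = While (RLess (ROfNat (NReg 1)) (RCell (NConst 0))) (SetReg 1 (NAdd (NReg 1) (NConst 1)))"

lemma runs_read_order:
  assumes "snd s 0 = real n" "fst s 1 \<le> n"
  shows "runs_within read_order s (2 * (n - fst s 1) + 1) (\<lambda>s'. s' = ((fst s)(1 := n), snd s))"
  using assms
proof (induction "n - fst s 1" arbitrary: s)
  case 0
  then have eq: "fst s 1 = n" by simp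
  then have "ram_exec read_order s 1 s"
    unfolding read_order_def using 0 by (intro ram_exec.WhileFalse) simp
  moreover have "s = ((fst s)(1 := n), snd s)" using eq by (metis fun_upd_triv prod.collapse)
  ultimately show ?case unfolding runs_within_def by fastforce
next
  case (Suc d)
  let ?s = "((fst s)(1 := fst s 1 + 1), snd s)"
  have "runs_within read_order ?s (2 * (n - fst ?s 1) + 1) (\<lambda>s'. s' = ((fst ?s)(1 := n), snd ?s))"
    using Suc.hyps(2) Suc.prems by (intro Suc.hyps(1)) auto
  then obtain t where t: "ram_exec read_order ?s t ((fst s)(1 := n), snd s)" "t \<le> 2 * (n - fst ?s 1) + 1"
    unfolding runs_within_def by auto
  have "ram_exec (SetReg 1 (NAdd (NReg 1) (NConst 1))) s 1 ?s"
    using ram_exec.SetReg[of 1 "NAdd (NReg 1) (NConst 1)" s] by simp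
  then have "ram_exec read_order s (1 + t + 1) ((fst s)(1 := n), snd s)"
    using t(1) Suc.hyps(2) Suc.prems unfolding read_order_def
    by (intro ram_exec.WhileTrue) auto
  moreover have "1 + t + 1 \<le> 2 * (n - fst s 1) + 1" using t(2) Suc.hyps(2) by simp
  ultimately show ?case unfolding runs_within_def by blast
qed

definition write_output :: ram_prog where
  "write_output = Seq
     (for_loop 2 (NReg 1) (for_loop 3 (NReg 1)
       (SetCell (flat_exp (NReg 2) (NReg 3)) (blend_exp 22 (NReg 2) (NReg 3)))))
     (SetReg 0 square_exp)"

text \<open>
  The output overwrites the input, which is harmless because the entries of the mean are
  computed from registers alone.
\<close>

lemma runs_write_output:
  assumes "fst s 1 = n"
  shows "runs_within write_output s (n * (n * (1 + 2) + 2 + 2) + 2 + 1)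
    (\<lambda>s'. ram_output s' = map (\<lambda>c. blend n (\<lambda>j. fst s (22 + j)) (c div n, c mod n)) [0..<n\<^sup>2])"
proof -
  let ?x = "blend n (\<lambda>j. fst s (22 + j))"
  let ?done = "\<lambda>m s'. agree_off {2, 3} (fst s) (fst s') \<and> (\<forall>c<m. snd s' c = ?x (c div n, c mod n))"
  have cell: "runs_within (SetCell (flat_exp (NReg 2) (NReg 3)) (blend_exp 22 (NReg 2) (NReg 3))) s' 1
     (\<lambda>s''. fst s'' = fst s' \<and> ?done (p * n + Suc q) s'')"
    if "p < n" "q < n" "fst s' 2 = p" "fst s' 3 = q" "?done (p * n + q) s'" for p q s'
  proof (rule runs_SetCell)
    have s': "fst s' r = fst s r" if "r \<notin> {2, 3}" for r
      using \<open>?done (p * n + q) s'\<close> that by (simp add: agree_off_def)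
    have "blend n (\<lambda>j. fst s' (22 + j)) = ?x" by (rule blend_cong) (simp add: s')
    then show "fst (fst s', (snd s')(nval (flat_exp (NReg 2) (NReg 3)) s' :=
        rval (blend_exp 22 (NReg 2) (NReg 3)) s')) = fst s' \<and>
      ?done (p * n + Suc q) (fst s', (snd s')(nval (flat_exp (NReg 2) (NReg 3)) s' :=
        rval (blend_exp 22 (NReg 2) (NReg 3)) s'))"
      using that assms s'[of 1] by (auto simp: flat_exp_def rval_blend_exp less_Suc_eq)
  qed
  have row: "runs_within (for_loop 3 (NReg 1)
       (SetCell (flat_exp (NReg 2) (NReg 3)) (blend_exp 22 (NReg 2) (NReg 3)))) s' (n * (1 + 2) + 2)
       (\<lambda>s'. fst s' 2 = p \<and> ?done (p * n + n) s')"
    if "p < n" "fst s' 2 = p" "?done (p * n) s'" for p s'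
  proof (rule runs_for_loop[where I = "\<lambda>q s'. fst s' 2 = p \<and> ?done (p * n + q) s'" and N = n])
    show "fst ((fst s')(3 := 0), snd s') 2 = p \<and> ?done (p * n + 0) ((fst s')(3 := 0), snd s')"
      using that by (simp add: agree_off_def)
    show "nval (NReg 1) s'' = n" if "fst s'' 2 = p \<and> ?done (p * n + i) s''" for i s''
      using that assms by (simp add: agree_off_def)
    show "runs_within (SetCell (flat_exp (NReg 2) (NReg 3)) (blend_exp 22 (NReg 2) (NReg 3))) s'' 1
      (\<lambda>s'. fst s' 3 = i \<and> fst ((fst s')(3 := Suc i), snd s') 2 = p \<and>
        ?done (p * n + Suc i) ((fst s')(3 := Suc i), snd s'))"
      if "i < n" "fst s'' 3 = i" "fst s'' 2 = p \<and> ?done (p * n + i) s''" for i s''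
      by (rule runs_mono[OF cell[of p i s'']]) (use that \<open>p < n\<close> in \<open>auto simp: agree_off_def\<close>)
  qed
  have "runs_within (for_loop 2 (NReg 1) (for_loop 3 (NReg 1)
       (SetCell (flat_exp (NReg 2) (NReg 3)) (blend_exp 22 (NReg 2) (NReg 3))))) s
       (n * (n * (1 + 2) + 2 + 2) + 2) (?done (n * n))"
  proof (rule runs_for_loop[where I = "\<lambda>p s'. ?done (p * n) s'" and N = n])
    show "?done (0 * n) ((fst s)(2 := 0), snd s)" by (simp add: agree_off_def)
    show "nval (NReg 1) s' = n" if "?done (i * n) s'" for i s'
      using that assms by (simp add: agree_off_def)
    show "runs_within (for_loop 3 (NReg 1)
       (SetCell (flat_exp (NReg 2) (NReg 3)) (blend_exp 22 (NReg 2) (NReg 3)))) s' (n * (1 + 2) + 2)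
       (\<lambda>s'. fst s' 2 = i \<and> ?done (Suc i * n) ((fst s')(2 := Suc i), snd s'))"
      if "i < n" "fst s' 2 = i" "?done (i * n) s'" for i s'
      by (rule runs_mono[OF row[of i s']]) (use that in \<open>auto simp: agree_off_def add.commute\<close>)
  qed
  then show ?thesis
    unfolding write_output_def
  proof (rule runs_Seq)
    fix s' assume "?done (n * n) s'"
    then show "runs_within (SetReg 0 square_exp) s' 1
      (\<lambda>s'. ram_output s' = map (\<lambda>c. ?x (c div n, c mod n)) [0..<n\<^sup>2])"
      using assms by (intro runs_SetReg)
        (simp add: ram_output_def square_exp_def agree_off_def power2_eq_square)
  qed
qed

text \<open>
  The length of the input determines n, but cell 0 contains it directly as a real number, from
  which counting recovers the register content.
\<close>

definition asqp_program :: ram_prog where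
  "asqp_program = Seq read_order (Seq (search 16) write_output)"

lemma loop_time_bound:
  assumes "T + 2 \<le> K * (n + 4) ^ j"
  shows "n * (T + 2) + 2 + 2 \<le> K * (n + 4 :: nat) ^ Suc j"
proof -
  have "n * (T + 2) + 2 + 2 \<le> (n + 4) * (T + 2)" by (simp add: algebra_simps)
  also have "\<dots> \<le> (n + 4) * (K * (n + 4) ^ j)" using assms by (rule mult_le_mono2)
  finally show ?thesis by (simp add: algebra_simps)
qed

lemma evaluate_time_bound: "evaluate_time n + 2 \<le> 5 * (n + 4) ^ 4"
proof -
  have pow: "1 \<le> (n + 4) ^ j" for j by simp
  have "1 + 2 \<le> 3 * (n + 4) ^ 0" by simp
  from loop_time_bound[OF loop_time_bound[OF this]]
  have "1 + (n * (n * (1 + 2) + 2 + 2) + 2) + 2 \<le> 4 * (n + 4) ^ Suc (Suc 0)"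
    using pow[of "Suc (Suc 0)"] by linarith
  from loop_time_bound[OF loop_time_bound[OF this]]
  have "evaluate_time n + 2 \<le> 4 * (n + 4) ^ Suc (Suc (Suc (Suc 0))) + 1"
    by (simp add: evaluate_time_def)
  moreover have "x ^ Suc (Suc (Suc (Suc 0))) = x ^ 4" for x :: nat
    by (simp add: eval_nat_numeral)
  ultimately have "evaluate_time n + 2 \<le> 4 * (n + 4) ^ 4 + 1" by simp
  then show ?thesis using pow[of 4] by linarith
qed

lemma search_time_bound: "search_time n m + 2 \<le> 30 * (n + 4) ^ (4 + m)"
proof (induction m)
  case 0
  have "1 \<le> (n + 4) ^ 4" by simp
  then show ?case using evaluate_time_bound[of n] unfolding search_time.simps add_0_right by linarith
next
  case (Suc m)
  show ?case using loop_time_bound[OF Suc.IH] by simp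
qed

lemma program_time_bound:
  assumes "n \<le> l"
  shows "2 * n + 1 + (search_time n 16 + (n * (n * (1 + 2) + 2 + 2) + 2 + 1)) \<le> 36 * 4 ^ 20 * (l + 1) ^ 20"
proof -
  have a: "2 * n + 1 \<le> 2 * (n + 4) ^ 20"
  proof -
    have "(n + 4) ^ 1 \<le> (n + 4) ^ 20" by (rule power_increasing) auto
    then show ?thesis by simp
  qed
  have c: "n * (n * (1 + 2) + 2 + 2) + 2 + 1 \<le> 4 * (n + 4) ^ 20"
  proof -
    have "1 + 2 \<le> 3 * (n + 4) ^ 0" by simp
    from loop_time_bound[OF loop_time_bound[OF this]]
    have "n * (n * (1 + 2) + 2 + 2) + 2 + 2 \<le> 3 * (n + 4) ^ Suc (Suc 0)" .
    moreover have "(n + 4) ^ Suc (Suc 0) \<le> (n + 4) ^ 20" by (rule power_increasing) auto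
    ultimately show ?thesis by linarith
  qed
  have "search_time n 16 + 2 \<le> 30 * (n + 4) ^ 20" using search_time_bound[of n 16] by simp
  with a c have "2 * n + 1 + (search_time n 16 + (n * (n * (1 + 2) + 2 + 2) + 2 + 1)) \<le> 36 * (n + 4) ^ 20"
    by linarith
  also have "\<dots> \<le> 36 * (4 * (l + 1)) ^ 20"
    using assms by (intro mult_le_mono2 power_mono) auto
  finally show ?thesis by (simp only: power_mult_distrib mult.assoc)
qed

section \<open>Correctness of the search\<close>

context asqp_instance
begin

abbreviation "tuple_cost \<rho> r \<equiv> cost n A b (blend n (\<lambda>j. \<rho> (r + j)))"

lemma runs_compare:
  assumes s: "holds_input s" and best: "\<forall>j<16. fst s (22 + j) < n" and cur: "\<forall>j<16. fst s (6 + j) < n"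
  shows "runs_within compare s (search_time n 0) (\<lambda>s'. holds_input s' \<and> (\<forall>j<16. fst s' (22 + j) < n) \<and>
    (\<forall>j<16. fst s' (6 + j) = fst s (6 + j)) \<and>
    tuple_cost (fst s') 22 \<le> tuple_cost (fst s) 22 \<and> tuple_cost (fst s') 22 \<le> tuple_cost (fst s) 6)"
    (is "runs_within _ _ _ ?Q")
proof -
  have "runs_within compare s (evaluate_time n + (evaluate_time n + (16 + 1 + 1))) ?Q"
    unfolding compare_def
  proof (intro runs_Seq)
    show "runs_within (evaluate 6 0) s (evaluate_time n) (\<lambda>s1. agree_off {2, 3, 4, 5} (fst s) (fst s1) \<and>
      snd s1 = (snd s)(len + 0 := tuple_cost (fst s) 6))"
      using s by (rule runs_evaluate) simp
    fix s1 assume s1: "agree_off {2, 3, 4, 5} (fst s) (fst s1) \<and>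
      snd s1 = (snd s)(len + 0 := tuple_cost (fst s) 6)"
    have in1: "holds_input s1" using s s1 by (auto simp: ready_def agree_off_def)
    have best1: "tuple_cost (fst s1) 22 = tuple_cost (fst s) 22"
      using s1 by (intro arg_cong[where f = "cost n A b"] blend_cong) (simp add: agree_off_def)
    show "runs_within (evaluate 22 1) s1 (evaluate_time n) (\<lambda>s2. agree_off {2, 3, 4, 5} (fst s1) (fst s2) \<and>
      snd s2 = (snd s1)(len + 1 := tuple_cost (fst s1) 22))"
      using in1 by (rule runs_evaluate) simp
    fix s2 assume s2: "agree_off {2, 3, 4, 5} (fst s1) (fst s2) \<and>
      snd s2 = (snd s1)(len + 1 := tuple_cost (fst s1) 22)"
    have regs: "fst s2 r = fst s r" if "r \<notin> {2, 3, 4, 5}" for r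
      using s1 s2 that by (simp add: agree_off_def)
    have in2: "holds_input s2" using in1 s2 by (auto simp: ready_def agree_off_def)
    have test: "bval (RLess (RCell (scratch 0)) (RCell (scratch 1))) s2
      \<longleftrightarrow> tuple_cost (fst s) 6 < tuple_cost (fst s) 22"
      using in2 s1 s2 best1 by (simp add: scratch_def ready_def)
    show "runs_within (If (RLess (RCell (scratch 0)) (RCell (scratch 1))) (copy_regs 16) Skip) s2 (16 + 1 + 1) ?Q"
    proof (rule runs_If)
      assume "bval (RLess (RCell (scratch 0)) (RCell (scratch 1))) s2"
      then have less: "tuple_cost (fst s) 6 < tuple_cost (fst s) 22" using test by simp
      show "runs_within (copy_regs 16) s2 (16 + 1) ?Q"
      proof (rule runs_mono[OF runs_copy_regs])
        fix s3 assume s3: "s3 = (\<lambda>r. if r \<in> {22..<22 + 16} then fst s2 (r - 16) else fst s2 r, snd s2)"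
        have new: "fst s3 (22 + j) = fst s (6 + j)" if "j < 16" for j
          using that s3 regs[of "6 + j"] by simp
        then have "tuple_cost (fst s3) 22 = tuple_cost (fst s) 6"
          by (intro arg_cong[where f = "cost n A b"] blend_cong) simp
        moreover have "holds_input s3" using in2 s3 by (simp add: ready_def)
        ultimately show "?Q s3" using new cur less s3 regs by simp
      qed simp_all
    next
      assume "\<not> bval (RLess (RCell (scratch 0)) (RCell (scratch 1))) s2"
      then have "tuple_cost (fst s) 22 \<le> tuple_cost (fst s) 6" using test by simp
      moreover have "tuple_cost (fst s2) 22 = tuple_cost (fst s) 22"
        by (intro arg_cong[where f = "cost n A b"] blend_cong) (simp add: regs)
      ultimately have "?Q s2" using in2 best regs by simp
      then show "runs_within Skip s2 (16 + 1) ?Q" by (rule runs_mono[OF runs_Skip]) simp_all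
    qed
  qed
  then show ?thesis by simp
qed

text \<open>
  The loops over the first m components have covered all tuples that agree with the current tuple in
  the remaining components.
\<close>

definition optimal_over :: "nat \<Rightarrow> (nat \<Rightarrow> nat) \<Rightarrow> real \<Rightarrow> bool" where
  "optimal_over m \<rho> \<beta> \<longleftrightarrow> (\<forall>\<tau>. (\<forall>j<m. \<tau> j < n) \<and> (\<forall>j. m \<le> j \<and> j < 16 \<longrightarrow> \<tau> j = \<rho> (6 + j)) \<longrightarrow>
     \<beta> \<le> cost n A b (blend n \<tau>))"

text \<open>
  The invariant of the loop over component m collects the optimality statements of the inner search
  for all values that the component has taken; a later improvement keeps them true, since the
  best cost never increases.
\<close>

lemma runs_search:
  assumes "m \<le> 16" "holds_input s" "\<forall>j<16. fst s (22 + j) < n"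
    "\<forall>j. m \<le> j \<and> j < 16 \<longrightarrow> fst s (6 + j) < n"
  shows "runs_within (search m) s (search_time n m) (\<lambda>s'. holds_input s' \<and> (\<forall>j<16. fst s' (22 + j) < n) \<and>
    (\<forall>j. m \<le> j \<and> j < 16 \<longrightarrow> fst s' (6 + j) = fst s (6 + j)) \<and>
    tuple_cost (fst s') 22 \<le> tuple_cost (fst s) 22 \<and>
    optimal_over m (fst s) (tuple_cost (fst s') 22))"
  using assms
proof (induction m arbitrary: s)
  case 0
  have *: "cost n A b (blend n \<tau>) = tuple_cost (fst s) 6" if "\<forall>j. 0 \<le> j \<and> j < 16 \<longrightarrow> \<tau> j = fst s (6 + j)" for \<tau>
    using that by (intro arg_cong[where f = "cost n A b"] blend_cong) simp
  have opt: "optimal_over 0 (fst s) \<beta>" if "\<beta> \<le> tuple_cost (fst s) 6" for \<beta>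
    unfolding optimal_over_def
  proof (intro allI impI)
    fix \<tau> assume \<tau>: "(\<forall>j<0. \<tau> j < n) \<and> (\<forall>j. 0 \<le> j \<and> j < 16 \<longrightarrow> \<tau> j = fst s (6 + j))"
    show "\<beta> \<le> cost n A b (blend n \<tau>)" unfolding *[OF \<tau>[THEN conjunct2]] by (rule that)
  qed
  have "runs_within compare s (search_time n 0) (\<lambda>s'. holds_input s' \<and> (\<forall>j<16. fst s' (22 + j) < n) \<and>
    (\<forall>j<16. fst s' (6 + j) = fst s (6 + j)) \<and>
    tuple_cost (fst s') 22 \<le> tuple_cost (fst s) 22 \<and> tuple_cost (fst s') 22 \<le> tuple_cost (fst s) 6)"
    using 0 by (intro runs_compare) auto
  then show ?case
    unfolding search.simps by (rule runs_mono) (simp_all add: opt)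
next
  case (Suc m)
  define I where "I i s' \<longleftrightarrow> holds_input s' \<and> (\<forall>j<16. fst s' (22 + j) < n) \<and>
    (\<forall>j. Suc m \<le> j \<and> j < 16 \<longrightarrow> fst s' (6 + j) = fst s (6 + j)) \<and>
    tuple_cost (fst s') 22 \<le> tuple_cost (fst s) 22 \<and>
    (\<forall>k<i. optimal_over m ((fst s)(6 + m := k)) (tuple_cost (fst s') 22))" for i s'
  have m: "m < 16" using Suc.prems(1) by simp
  \<comment> \<open>The invariant does not mention the counter, hence survives its increment.\<close>
  have shift: "I i ((fst s')(6 + m := k), snd s') \<longleftrightarrow> I i s'" for i k s'
  proof -
    have "tuple_cost ((fst s')(6 + m := k)) 22 = tuple_cost (fst s') 22"
      using m by (intro arg_cong[where f = "cost n A b"] blend_cong) simp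
    moreover have "holds_input ((fst s')(6 + m := k), snd s') \<longleftrightarrow> holds_input s'"
      by (simp add: ready_def)
    ultimately show ?thesis using m by (auto simp: I_def)
  qed
  have "runs_within (search (Suc m)) s (n * (search_time n m + 2) + 2) (I n)"
    unfolding search.simps
  proof (rule runs_for_loop[where I = I and N = n])
    show "I 0 ((fst s)(6 + m := 0), snd s)" using Suc.prems unfolding shift by (simp add: I_def)
    show "nval (NReg 1) s' = n" if "I i s'" for i s' using that by (simp add: I_def ready_def)
    fix i s' assume i: "i < n" "fst s' (6 + m) = i" "I i s'"
    have "fst s' (6 + j) < n" if "m \<le> j" "j < 16" for j
      using i Suc.prems(4) that unfolding I_def by (cases "j = m") auto
    then have "runs_within (search m) s' (search_time n m) (\<lambda>s''. holds_input s'' \<and> (\<forall>j<16. fst s'' (22 + j) < n) \<and>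
      (\<forall>j. m \<le> j \<and> j < 16 \<longrightarrow> fst s'' (6 + j) = fst s' (6 + j)) \<and>
      tuple_cost (fst s'') 22 \<le> tuple_cost (fst s') 22 \<and>
      optimal_over m (fst s') (tuple_cost (fst s'') 22))"
      using i(3) m by (intro Suc.IH) (auto simp: I_def)
    then show "runs_within (search m) s' (search_time n m)
      (\<lambda>s''. fst s'' (6 + m) = i \<and> I (Suc i) ((fst s'')(6 + m := Suc i), snd s''))"
      unfolding shift
    proof (rule runs_mono)
      fix s'' assume s'': "holds_input s'' \<and> (\<forall>j<16. fst s'' (22 + j) < n) \<and>
        (\<forall>j. m \<le> j \<and> j < 16 \<longrightarrow> fst s'' (6 + j) = fst s' (6 + j)) \<and>
        tuple_cost (fst s'') 22 \<le> tuple_cost (fst s') 22 \<and>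
        optimal_over m (fst s') (tuple_cost (fst s'') 22)"
      have "optimal_over m ((fst s)(6 + m := k)) (tuple_cost (fst s'') 22)" if "k < Suc i" for k
      proof (cases "k = i")
        case True
        have "fst s' (6 + j) = ((fst s)(6 + m := k)) (6 + j)" if "m \<le> j" "j < 16" for j
          using i that True unfolding I_def by (cases "j = m") auto
        then show ?thesis using s'' unfolding optimal_over_def by metis
      next
        case False
        then have "optimal_over m ((fst s)(6 + m := k)) (tuple_cost (fst s') 22)"
          using i(3) that by (simp add: I_def)
        then show ?thesis using s'' unfolding optimal_over_def by (meson order_trans)
      qed
      then show "fst s'' (6 + m) = i \<and> I (Suc i) s''"
        using s'' i m unfolding I_def by (auto intro: order_trans)
    qed simp
  qed
  then show ?case
    unfolding search_time.simps
  proof (rule runs_mono)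
    fix s' assume s': "I n s'"
    have "optimal_over (Suc m) (fst s) (tuple_cost (fst s') 22)"
      unfolding optimal_over_def
    proof (intro allI impI)
      fix \<tau> assume \<tau>: "(\<forall>j<Suc m. \<tau> j < n) \<and> (\<forall>j. Suc m \<le> j \<and> j < 16 \<longrightarrow> \<tau> j = fst s (6 + j))"
      have opt: "optimal_over m ((fst s)(6 + m := \<tau> m)) (tuple_cost (fst s') 22)"
        using s' \<tau> by (simp add: I_def)
      have "\<tau> j = ((fst s)(6 + m := \<tau> m)) (6 + j)" if "m \<le> j" "j < 16" for j
        using \<tau> that by (cases "j = m") auto
      moreover have "\<forall>j<m. \<tau> j < n" using \<tau> by simp
      ultimately have "(\<forall>j<m. \<tau> j < n) \<and>
          (\<forall>j. m \<le> j \<and> j < 16 \<longrightarrow> \<tau> j = ((fst s)(6 + m := \<tau> m)) (6 + j))"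
        by blast
      then show "tuple_cost (fst s') 22 \<le> cost n A b (blend n \<tau>)"
        by (rule mp[OF spec[OF opt[unfolded optimal_over_def]]])
    qed
    then show "holds_input s' \<and> (\<forall>j<16. fst s' (22 + j) < n) \<and>
      (\<forall>j. Suc m \<le> j \<and> j < 16 \<longrightarrow> fst s' (6 + j) = fst s (6 + j)) \<and>
      tuple_cost (fst s') 22 \<le> tuple_cost (fst s) 22 \<and> optimal_over (Suc m) (fst s) (tuple_cost (fst s') 22)"
      using s' by (simp add: I_def)
  qed simp
qed

lemma runs_program:
  "runs_within asqp_program (ram_input code) (36 * 4 ^ 20 * (len + 1) ^ 20) (\<lambda>s. \<exists>\<tau>. (\<forall>j<16. \<tau> j < n) \<and>
    (\<forall>\<sigma>. (\<forall>j<16. \<sigma> j < n) \<longrightarrow> cost n A b (blend n \<tau>) \<le> cost n A b (blend n \<sigma>)) \<and>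
    ram_output s = map (\<lambda>c. blend n \<tau> (c div n, c mod n)) [0..<n\<^sup>2])"
    (is "runs_within _ _ _ ?Q")
proof (rule runs_mono)
  let ?s = "ram_input code"
  have s: "snd ?s 0 = real n" "fst ?s 1 = 0"
    using code_order len_eq by (simp_all add: ram_input_def)
  show "runs_within asqp_program ?s
    (2 * n + 1 + (search_time n 16 + (n * (n * (1 + 2) + 2 + 2) + 2 + 1))) ?Q"
    unfolding asqp_program_def
  proof (intro runs_Seq)
    show "runs_within read_order ?s (2 * n + 1) (\<lambda>s'. s' = ((fst ?s)(1 := n), snd ?s))"
      using runs_read_order[of ?s n] s by simp
    fix s1 assume s1: "s1 = ((fst ?s)(1 := n), snd ?s)"
    have in1: "holds_input s1" using s1 by (simp add: ready_def ram_input_def)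
    show "runs_within (search 16) s1 (search_time n 16) (\<lambda>s'. holds_input s' \<and> (\<forall>j<16. fst s' (22 + j) < n) \<and>
      (\<forall>j. 16 \<le> j \<and> j < 16 \<longrightarrow> fst s' (6 + j) = fst s1 (6 + j)) \<and>
      tuple_cost (fst s') 22 \<le> tuple_cost (fst s1) 22 \<and>
      optimal_over 16 (fst s1) (tuple_cost (fst s') 22))"
      using in1 n s1 by (intro runs_search) (auto simp: ram_input_def)
    fix s2 assume s2: "holds_input s2 \<and> (\<forall>j<16. fst s2 (22 + j) < n) \<and>
      (\<forall>j. 16 \<le> j \<and> j < 16 \<longrightarrow> fst s2 (6 + j) = fst s1 (6 + j)) \<and>
      tuple_cost (fst s2) 22 \<le> tuple_cost (fst s1) 22 \<and>
      optimal_over 16 (fst s1) (tuple_cost (fst s2) 22)"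
    have "fst s2 1 = n" using s2 by (simp add: ready_def)
    then have "runs_within write_output s2 (n * (n * (1 + 2) + 2 + 2) + 2 + 1)
      (\<lambda>s'. ram_output s' = map (\<lambda>c. blend n (\<lambda>j. fst s2 (22 + j)) (c div n, c mod n)) [0..<n\<^sup>2])"
      by (rule runs_write_output)
    then show "runs_within write_output s2 (n * (n * (1 + 2) + 2 + 2) + 2 + 1) ?Q"
    proof (rule runs_mono)
      fix s3 assume out: "ram_output s3 = map (\<lambda>c. blend n (\<lambda>j. fst s2 (22 + j)) (c div n, c mod n)) [0..<n\<^sup>2]"
      show "?Q s3"
        by (rule exI[of _ "\<lambda>j. fst s2 (22 + j)"]) (use s2 out in \<open>auto simp: optimal_over_def\<close>)
    qed simp
  qed
  show "2 * n + 1 + (search_time n 16 + (n * (n * (1 + 2) + 2 + 2) + 2 + 1)) \<le> 36 * 4 ^ 20 * (len + 1) ^ 20"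
  proof (rule program_time_bound)
    have "n \<le> n * n" by simp
    then show "n \<le> len" using len_eq by linarith
  qed
qed

end

section \<open>The best mean of anchors is an approximate minimizer\<close>

text \<open>
  The analysis indexes points by pairs, the problem by the row-major position.
\<close>

definition flat_vec :: "nat \<Rightarrow> (nat \<times> nat \<Rightarrow> real) \<Rightarrow> real vec" where
  "flat_vec n x = vec (n\<^sup>2) (\<lambda>c. x (c div n, c mod n))"

lemma flat_vec_index: "p < n \<Longrightarrow> q < n \<Longrightarrow> flat_vec n x $ (p * n + q) = x (p, q)"
  using flat_less[of p n q] by (simp add: flat_vec_def power2_eq_square)

lemma flat_vec_mem: "flat_vec n x \<in> assignment_polytope n \<longleftrightarrow> doubly_stochastic n x"
  unfolding assignment_polytope_def doubly_stochastic_def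
  by (simp add: flat_vec_index) (simp add: flat_vec_def)

lemma sum_flat: "(\<Sum>c<n\<^sup>2. f c) = (\<Sum>c\<in>square n. f (flat n c :: nat))"
proof -
  have "(\<Sum>j<n. f (i * n + j)) = sum f {i * n..<i * n + n}" for i
    by (intro sum.reindex_bij_witness[of _ "\<lambda>c. c - i * n" "\<lambda>j. i * n + j"]) auto
  then show ?thesis by (simp add: sum_square flat_def sum.nat_group power2_eq_square)
qed

context asqp_instance
begin

lemma objective_eq_cost: "asqp_objective A b (flat_vec n x) = cost n A b x"
proof -
  have val: "flat_vec n x $ flat n c = x c" if "c \<in> square n" for c
    using that by (auto simp: square_def flat_def flat_vec_index)
  have bound: "flat n c < n\<^sup>2" if "c \<in> square n" for c
    using that flat_less by (auto simp: square_def flat_def power2_eq_square)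
  have dims: "dim_row A = n\<^sup>2" "dim_col A = n\<^sup>2" "dim_vec b = n\<^sup>2" "dim_vec (flat_vec n x) = n\<^sup>2"
    using A b by (auto simp: flat_vec_def)
  have "flat_vec n x \<bullet> (A *\<^sub>v flat_vec n x)
    = (\<Sum>c\<in>square n. flat_vec n x $ flat n c * (\<Sum>d\<in>square n. A $$ (flat n c, flat n d) * flat_vec n x $ flat n d))"
    using bound by (simp add: scalar_prod_def dims atLeast0LessThan sum_flat)
  moreover have "b \<bullet> flat_vec n x = (\<Sum>c\<in>square n. b $ flat n c * flat_vec n x $ flat n c)"
    by (simp add: scalar_prod_def dims atLeast0LessThan sum_flat)
  ultimately show ?thesis
    by (simp add: asqp_objective_def cost_def quad_def val sum_distrib_left mult.assoc mult.left_commute)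
qed

lemma polytope_eq: "assignment_polytope n = flat_vec n ` {x. doubly_stochastic n x}"
proof (intro equalityI subsetI)
  fix y assume y: "y \<in> assignment_polytope n"
  have "y = flat_vec n (\<lambda>c. y $ flat n c)"
    using y by (intro eq_vecI) (auto simp: flat_vec_def assignment_polytope_def flat_def)
  moreover from this have "doubly_stochastic n (\<lambda>c. y $ flat n c)"
    using y flat_vec_mem by metis
  ultimately show "y \<in> flat_vec n ` {x. doubly_stochastic n x}" by blast
qed (auto simp: flat_vec_mem)

text \<open>
  Boundedness makes the supremum and the infimum in the problem genuine bounds. The constant
  comes from the fact that all entries of a doubly stochastic matrix lie between 0 and 1.
\<close>

lemma cost_bounded:
  assumes x: "doubly_stochastic n x"
  shows "\<bar>cost n A b x\<bar> \<le> (\<Sum>c\<in>square n. \<Sum>d\<in>square n. \<bar>A $$ (flat n c, flat n d)\<bar>)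
    + 2 * (\<Sum>c\<in>square n. \<bar>b $ flat n c\<bar>)"
proof -
  have unit: "\<bar>x c\<bar> \<le> 1" if c_in: "c \<in> square n" for c
  proof -
    obtain i j where c: "c = (i, j)" "i < n" "j < n" using c_in unfolding square_def by blast
    then have "x (i, j) \<le> (\<Sum>j<n. x (i, j))"
      using x by (intro member_le_sum) (auto simp: doubly_stochastic_def)
    then show ?thesis using x c by (simp add: doubly_stochastic_def)
  qed
  have "\<bar>\<Sum>c\<in>square n. \<Sum>d\<in>square n. A $$ (flat n c, flat n d) * x c * x d\<bar>
    \<le> (\<Sum>c\<in>square n. \<Sum>d\<in>square n. \<bar>A $$ (flat n c, flat n d)\<bar>)"
  proof (intro order_trans[OF sum_abs] sum_mono)
    fix c d assume "c \<in> square n" "d \<in> square n"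
    then have "\<bar>x c\<bar> * \<bar>x d\<bar> \<le> 1" using unit by (intro mult_le_one) auto
    then show "\<bar>A $$ (flat n c, flat n d) * x c * x d\<bar> \<le> \<bar>A $$ (flat n c, flat n d)\<bar>"
      by (simp add: abs_mult mult.assoc mult_left_le)
  qed
  moreover have "\<bar>\<Sum>c\<in>square n. b $ flat n c * x c\<bar> \<le> (\<Sum>c\<in>square n. \<bar>b $ flat n c\<bar>)"
    by (intro order_trans[OF sum_abs] sum_mono) (simp add: abs_mult mult_left_le unit)
  ultimately show ?thesis unfolding cost_def quad_def by linarith
qed

text \<open>
  The sampling and extrapolation bound holds for every point x with one and the same gap at the best
  mean; passing to the infimum over x turns it into the claim, without choosing a minimizer.
\<close>

lemma best_blend_eps_minimal:
  assumes valid: "\<forall>j<16. \<tau> j < n"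
    and best: "\<forall>\<sigma>. (\<forall>j<16. \<sigma> j < n) \<longrightarrow> cost n A b (blend n \<tau>) \<le> cost n A b (blend n \<sigma>)"
  shows "eps_minimal_solution (1 - asqp_g n) n A b (flat_vec n (blend n \<tau>))"
proof -
  let ?f = "asqp_objective A b" and ?\<beta> = "cost n A b (blend n \<tau>)"
  define B where "B = (\<Sum>c\<in>square n. \<Sum>d\<in>square n. \<bar>A $$ (flat n c, flat n d)\<bar>)
    + 2 * (\<Sum>c\<in>square n. \<bar>b $ flat n c\<bar>)"
  let ?S = "asqp_max n A b" and ?m = "asqp_min n A b"
  have "\<bar>?f y\<bar> \<le> B" if "y \<in> assignment_polytope n" for y
    using that cost_bounded unfolding polytope_eq B_def by (auto simp: objective_eq_cost)
  then have bdd: "bdd_above (?f ` assignment_polytope n)"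
    by (intro bdd_aboveI[of _ B]) force
  have upper: "cost n A b x \<le> ?S" if "doubly_stochastic n x" for x
    unfolding asqp_max_def objective_eq_cost[symmetric]
    using bdd that by (intro cSUP_upper) (simp_all add: flat_vec_mem)
  have member: "doubly_stochastic n (blend n \<tau>)"
  proof -
    have "doubly_stochastic n (\<lambda>c. \<Sum>m<8. 1 / 8 * anchor n (\<tau> (2 * m), \<tau> (2 * m + 1)) c)"
      using n valid by (intro doubly_stochastic_mixture doubly_stochastic_anchor) auto
    then show ?thesis by (simp add: blend_def[abs_def] sum_divide_distrib)
  qed
  have key: "7 / 8 * (?S - cost n A b x) \<le> (2 * real n - 3)\<^sup>2 * (?S - ?\<beta>)" if x: "doubly_stochastic n x" for x
  proof -
    have "(1 - 1 / real 8) * (?S - cost n A b x) \<le> (2 * real n - 3)\<^sup>2 * (?S - ?\<beta>)"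
    proof (rule anchor_means_approximate[OF n, where k = 8
          and M = "\<lambda>c d. A $$ (flat n c, flat n d)" and l = "\<lambda>c. b $ flat n c", folded cost_def])
      fix \<alpha> :: "nat \<Rightarrow> nat \<times> nat" assume \<alpha>: "\<And>m. \<alpha> m \<in> square n"
      define \<sigma> where "\<sigma> j = (if even j then fst (\<alpha> (j div 2)) else snd (\<alpha> (j div 2)))" for j
      have "?\<beta> \<le> cost n A b (blend n \<sigma>)"
        using best \<alpha> by (auto simp: \<sigma>_def square_def mem_Times_iff)
      also have "blend n \<sigma> = (\<lambda>c. (\<Sum>m<8. anchor n (\<alpha> m) c) / real 8)"
        by (simp add: blend_def \<sigma>_def fun_eq_iff)
      finally show "?\<beta> \<le> cost n A b (\<lambda>c. (\<Sum>m<8. anchor n (\<alpha> m) c) / real 8)" .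
    qed (use upper x in auto)
    then show ?thesis by simp
  qed
  have gap0: "0 \<le> ?S - ?\<beta>" using upper[OF member] by simp
  have all: "asqp_g n * (?S - cost n A b x) \<le> ?S - ?\<beta>" if x: "doubly_stochastic n x" for x
  proof -
    have g0: "0 \<le> asqp_g n" by (simp add: asqp_g_def)
    have "7 / 8 * (asqp_g n * (?S - cost n A b x)) = asqp_g n * (7 / 8 * (?S - cost n A b x))" by simp
    also have "\<dots> \<le> asqp_g n * ((2 * real n - 3)\<^sup>2 * (?S - ?\<beta>))"
      using g0 key[OF x] by (rule mult_left_mono[rotated])
    also have "\<dots> = (asqp_g n * (2 * real n - 3)\<^sup>2) * (?S - ?\<beta>)" by simp
    also have "\<dots> \<le> 7 / 8 * (?S - ?\<beta>)"
      using gap0 asqp_g_bounds(2)[OF n] by (intro mult_right_mono)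
    finally show ?thesis by simp
  qed
  have gpos: "0 < asqp_g n" using n by (rule asqp_g_bounds)
  have "?S - (?S - ?\<beta>) / asqp_g n \<le> ?m"
    unfolding asqp_min_def
  proof (rule cINF_greatest)
    show "assignment_polytope n \<noteq> {}" using member flat_vec_mem by blast
    fix y assume "y \<in> assignment_polytope n"
    then obtain x where x: "y = flat_vec n x" "doubly_stochastic n x" unfolding polytope_eq by blast
    have "?S - cost n A b x \<le> (?S - ?\<beta>) / asqp_g n"
      using all[OF x(2)] gpos by (simp add: pos_le_divide_eq mult.commute)
    then show "?S - (?S - ?\<beta>) / asqp_g n \<le> ?f y" by (simp add: x(1) objective_eq_cost)
  qed
  then have "asqp_g n * (?S - ?m) \<le> ?S - ?\<beta>"
    using gpos by (simp add: field_simps)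
  then have main: "?\<beta> - ?m \<le> (1 - asqp_g n) * (?S - ?m)" by (simp add: algebra_simps)
  have "bdd_below (?f ` assignment_polytope n)"
    using \<open>\<And>y. y \<in> assignment_polytope n \<Longrightarrow> \<bar>?f y\<bar> \<le> B\<close>
    by (intro bdd_belowI[of _ "- B"]) force
  then have "?m \<le> ?\<beta>"
    unfolding asqp_min_def objective_eq_cost[symmetric]
    using member by (intro cINF_lower) (simp_all add: flat_vec_mem)
  then have "?m \<le> ?S" using gap0 by simp
  then show ?thesis
    using main member unfolding eps_minimal_solution_def
    by (auto simp: flat_vec_mem objective_eq_cost pos_divide_le_eq)
qed

end

theorem corollary1:
  shows "poly_time_solvable asqp_instances asqp_encode
    (\<lambda>(n, A, b) ys. eps_minimal_solution (1 - asqp_g n) n A b (vec_of_list ys))"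
  unfolding poly_time_solvable_def
proof (rule exI[of _ asqp_program], rule exI[of _ "36 * 4 ^ 20"], rule exI[of _ 20], rule ballI)
  fix i assume "i \<in> asqp_instances"
  then obtain n A b where i: "i = (n, A, b)" "2 \<le> n" "A \<in> carrier_mat (n\<^sup>2) (n\<^sup>2)" "b \<in> carrier_vec (n\<^sup>2)"
    unfolding asqp_instances_def by auto
  interpret asqp_instance n A b using i(2-4) by unfold_locales
  obtain t s \<tau> where run: "ram_exec asqp_program (ram_input code) t s" "t \<le> 36 * 4 ^ 20 * (len + 1) ^ 20"
    and \<tau>: "\<forall>j<16. \<tau> j < n"
      "\<forall>\<sigma>. (\<forall>j<16. \<sigma> j < n) \<longrightarrow> cost n A b (blend n \<tau>) \<le> cost n A b (blend n \<sigma>)"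
    and out: "ram_output s = map (\<lambda>c. blend n \<tau> (c div n, c mod n)) [0..<n\<^sup>2]"
    using runs_program unfolding runs_within_def by blast
  have "vec_of_list (ram_output s) = flat_vec n (blend n \<tau>)"
    unfolding out by (intro eq_vecI) (simp_all add: flat_vec_def vec_of_list_index)
  then have "eps_minimal_solution (1 - asqp_g n) n A b (vec_of_list (ram_output s))"
    using best_blend_eps_minimal[OF \<tau>] by simp
  then show "\<exists>t s. ram_exec asqp_program (ram_input (asqp_encode i)) t s \<and>
      t \<le> 36 * 4 ^ 20 * (length (asqp_encode i) + 1) ^ 20 \<and>
      (case i of (n, A, b) \<Rightarrow> \<lambda>ys. eps_minimal_solution (1 - asqp_g n) n A b (vec_of_list ys)) (ram_output s)"
    unfolding i(1) prod.case using run by blast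
qed

end
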